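(* Let $A$ be an associative unital algebra with multiplication $\mu$ and unit $1_A$, let $V$ be a vector space with a distinguished element $1_V\in V$, and let $A\otimes_{R,\sigma}V$ and $A\otimes_{R',\sigma'}V$ be two crossed products. Then $A\otimes_{R,\sigma}V$ and $A\otimes_{R',\sigma'}V$ are equivalent if and only if there exist linear maps $\theta,\gamma:V\to A\otimes V$, with notation $\theta(v)=v_{<-1>}\otimes v_{<0>}$ and $\gamma(v)=v_{\{-1\}}\otimes v_{\{0\}}$ for all $v\in V$, such that all of the following conditions are satisfied: (i) $R'=(\mu_2\otimes \mathrm{id}_V)\circ(\mathrm{id}_A\otimes \mathrm{id}_A\otimes\gamma)\circ(\mathrm{id}_A\otimes R)\circ(\theta\otimes \mathrm{id}_A)$; (ii) $\sigma'=(\mu\otimes \mathrm{id}_V)\circ(\mathrm{id}_A\otimes\gamma)\circ(\mu_2\otimes \mathrm{id}_V)\circ(\mathrm{id}_A\otimes \mathrm{id}_A\otimes\sigma)\circ(\mathrm{id}_A\otimes R\otimes \mathrm{id}_V)\circ(\theta\otimes\theta)$; (iii) $\theta(1_V)=1_A\otimes 1_V$ and $\gamma(1_V)=1_A\otimes 1_V$; (iv) $v_{<-1>}v_{<0>_{\{-1\}}}\otimes v_{<0>_{\{0\}}}=1_A\otimes v$ for all $v\in V$; (v) $v_{\{-1\}}v_{\{0\}_{<-1>}}\otimes v_{\{0\}_{<0>}}=1_A\otimes v$ for all $v\in V$; (vi) $(\mu\otimes \mathrm{id}_V)\circ(\mu\otimes\sigma')\circ(\mathrm{id}_A\otimes\gamma\otimes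 \mathrm{id}_V)\circ(R\otimes \mathrm{id}_V)\circ(\mathrm{id}_V\otimes\gamma)=(\mu\otimes \mathrm{id}_V)\circ(\mathrm{id}_A\otimes\gamma)\circ\sigma$ (as maps $V\otimes V\to A\otimes V$).
   Context: Everything is over a fixed field $k$; $\otimes=\otimes_k$. Put $\mu_2=\mu\circ(\mathrm{id}_A\otimes\mu)=\mu\circ(\mu\otimes \mathrm{id}_A):A\otimes A\otimes A\to A$. Crossed product (Brzeziński). Let $(A,\mu,1_A)$ be an associative unital algebra and $V$ a vector space with a distinguished element $1_V\in V$. Let $R:V\otimes A\to A\otimes V$ and $\sigma:V\otimes V\to A\otimes V$ be linear maps satisfying, for all $a\in A$, $v\in V$: (1) $R(1_V\otimes a)=a\otimes 1_V$ and $R(v\otimes 1_A)=1_A\otimes v$; (2) $\sigma(1_V,v)=\sigma(v,1_V)=1_A\otimes v$; (3) $R\circ(\mathrm{id}_V\otimes\mu)=(\mu\otimes \mathrm{id}_V)\circ(\mathrm{id}_A\otimes R)\circ(R\otimes \mathrm{id}_A)$; (4) $(\mu\otimes \mathrm{id}_V)\circ(\mathrm{id}_A\otimes\sigma)\circ(R\otimes \mathrm{id}_V)\circ(\mathrm{id}_V\otimes\sigma)=(\mu\otimes \mathrm{id}_V)\circ(\mathrm{id}_A\otimes\sigma)\circ(\sigma\otimes \mathrm{id}_V)$; (5) $(\mu\otimes \mathrm{id}_V)\circ(\mathrm{id}_A\otimes\sigma)\circ(R\otimes \mathrm{id}_V)\circ(\mathrm{id}_V\otimes R)=(\mu\otimes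 \mathrm{id}_V)\circ(\mathrm{id}_A\otimes R)\circ(\sigma\otimes \mathrm{id}_A)$. Then $A\otimes V$ is an associative algebra with unit $1_A\otimes 1_V$ and multiplication $(\mu_2\otimes \mathrm{id}_V)\circ(\mathrm{id}_A\otimes \mathrm{id}_A\otimes\sigma)\circ(\mathrm{id}_A\otimes R\otimes \mathrm{id}_V)$; it is denoted $A\otimes_{R,\sigma}V$ and called the crossed product afforded by $(A,V,R,\sigma)$. Two crossed products $A\otimes_{R,\sigma}V$ and $A\otimes_{R',\sigma'}V$ (same $A$, same $V$, same $1_V$) are called equivalent if there exists an algebra isomorphism $\varphi:A\otimes_{R',\sigma'}V\simeq A\otimes_{R,\sigma}V$ such that $\varphi(a\otimes 1_V)=a\otimes 1_V$ for all $a\in A$. Sweedler-type notation (sums suppressed): iterated subscripts mean successive application of maps, e.g. $v_{<-1>}v_{<0>_{\{-1\}}}\otimes v_{<0>_{\{0\}}}$ is $(\mu\otimes \mathrm{id}_V)\circ(\mathrm{id}_A\otimes\gamma)\circ\theta$ applied to $v$. *)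

theory Defs
  imports "HOL-Algebra.Module" "HOL-Algebra.QuotRing"
begin

section \<open>Vector spaces, linear maps, associative algebras\<close>

text \<open>
  Vector spaces over a field \<open>K\<close> are structures \<open>M\<close> with \<open>module K M\<close>; their ring
  multiplication and ring unit fields play no role. Maps are only meaningful on carriers, and two
  maps are equal if they agree on the carrier of the domain.
\<close>

definition linear_maps ::
  "'k ring \<Rightarrow> ('k, 'm) module \<Rightarrow> ('k, 'n) module \<Rightarrow> ('m \<Rightarrow> 'n) set" where
  "linear_maps K M N = {f \<in> carrier M \<rightarrow> carrier N.
     (\<forall>x\<in>carrier M. \<forall>y\<in>carrier M. f (x \<oplus>\<^bsub>M\<^esub> y) = f x \<oplus>\<^bsub>N\<^esub> f y) \<and>
     (\<forall>c\<in>carrier K. \<forall>x\<in>carrier M. f (c \<odot>\<^bsub>M\<^esub> x) = c \<odot>\<^bsub>N\<^esub> f x)}"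

text \<open>The locale \<open>algebra\<close> of the library requires commutativity.\<close>

locale assoc_algebra = module + ring M +
  assumes smult_mult_left:
      "\<lbrakk>c \<in> carrier R; x \<in> carrier M; y \<in> carrier M\<rbrakk> \<Longrightarrow>
       (c \<odot>\<^bsub>M\<^esub> x) \<otimes>\<^bsub>M\<^esub> y = c \<odot>\<^bsub>M\<^esub> (x \<otimes>\<^bsub>M\<^esub> y)"
    and smult_mult_right:
      "\<lbrakk>c \<in> carrier R; x \<in> carrier M; y \<in> carrier M\<rbrakk> \<Longrightarrow>
       x \<otimes>\<^bsub>M\<^esub> (c \<odot>\<^bsub>M\<^esub> y) = c \<odot>\<^bsub>M\<^esub> (x \<otimes>\<^bsub>M\<^esub> y)"


section \<open>Tensor products\<close>

text \<open>
  \<open>M \<boxtimes> N\<close> is the free \<open>K\<close>-module on the set \<open>carrier M \<times> carrier N\<close> modulo the submodule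
  generated by the bilinearity relations.
\<close>

definition free_module :: "'k ring \<Rightarrow> 'x set \<Rightarrow> ('k, 'x \<Rightarrow> 'k) module" where
  "free_module K U = \<lparr>
     carrier = {f. (\<forall>p. f p \<in> carrier K) \<and> (\<forall>p. p \<notin> U \<longrightarrow> f p = \<zero>\<^bsub>K\<^esub>) \<and> finite {p. f p \<noteq> \<zero>\<^bsub>K\<^esub>}},
     mult = undefined, one = undefined,
     zero = (\<lambda>p. \<zero>\<^bsub>K\<^esub>),
     add = (\<lambda>f g p. f p \<oplus>\<^bsub>K\<^esub> g p),
     smult = (\<lambda>c f p. c \<otimes>\<^bsub>K\<^esub> f p)\<rparr>"

definition free_gen :: "'k ring \<Rightarrow> 'x \<Rightarrow> 'x \<Rightarrow> 'k" where
  "free_gen K x = (\<lambda>p. if p = x then \<one>\<^bsub>K\<^esub> else \<zero>\<^bsub>K\<^esub>)"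

definition submodule_span :: "'k ring \<Rightarrow> ('k, 'm) module \<Rightarrow> 'm set \<Rightarrow> 'm set" where
  "submodule_span K M S = \<Inter>{H. submodule H K M \<and> S \<subseteq> H}"

definition quotient_module :: "'k ring \<Rightarrow> ('k, 'm) module \<Rightarrow> 'm set \<Rightarrow> ('k, 'm set) module" where
  "quotient_module K M H = \<lparr>
     carrier = a_rcosets\<^bsub>M\<^esub> H,
     mult = undefined, one = undefined,
     zero = H,
     add = (\<lambda>C D. C <+>\<^bsub>M\<^esub> D),
     smult = (\<lambda>c C. H <+>\<^bsub>M\<^esub> ((\<lambda>x. c \<odot>\<^bsub>M\<^esub> x) ` C))\<rparr>"

definition bilinear_relations ::
  "'k ring \<Rightarrow> ('k, 'm) module \<Rightarrow> ('k, 'n) module \<Rightarrow> ('m \<times> 'n \<Rightarrow> 'k) set" where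
  "bilinear_relations K M N =
    (let F = free_module K (carrier M \<times> carrier N); g = (\<lambda>m n. free_gen K (m, n)) in
       {g (m \<oplus>\<^bsub>M\<^esub> m') n \<ominus>\<^bsub>F\<^esub> (g m n \<oplus>\<^bsub>F\<^esub> g m' n) |
          m m' n. m \<in> carrier M \<and> m' \<in> carrier M \<and> n \<in> carrier N} \<union>
       {g m (n \<oplus>\<^bsub>N\<^esub> n') \<ominus>\<^bsub>F\<^esub> (g m n \<oplus>\<^bsub>F\<^esub> g m n') |
          m n n'. m \<in> carrier M \<and> n \<in> carrier N \<and> n' \<in> carrier N} \<union>
       {g (c \<odot>\<^bsub>M\<^esub> m) n \<ominus>\<^bsub>F\<^esub> (c \<odot>\<^bsub>F\<^esub> g m n) |
          c m n. c \<in> carrier K \<and> m \<in> carrier M \<and> n \<in> carrier N} \<union>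
       {g m (c \<odot>\<^bsub>N\<^esub> n) \<ominus>\<^bsub>F\<^esub> (c \<odot>\<^bsub>F\<^esub> g m n) |
          c m n. c \<in> carrier K \<and> m \<in> carrier M \<and> n \<in> carrier N})"

definition tensor_null ::
  "'k ring \<Rightarrow> ('k, 'm) module \<Rightarrow> ('k, 'n) module \<Rightarrow> ('m \<times> 'n \<Rightarrow> 'k) set" where
  "tensor_null K M N =
     submodule_span K (free_module K (carrier M \<times> carrier N)) (bilinear_relations K M N)"

definition tensor_product ::
  "('k, 'm) module \<Rightarrow> 'k ring \<Rightarrow> ('k, 'n) module \<Rightarrow> ('k, ('m \<times> 'n \<Rightarrow> 'k) set) module"
  ("(_ \<boxtimes>\<^bsub>_\<^esub> _)" [76, 0, 75] 75) where
  "M \<boxtimes>\<^bsub>K\<^esub> N =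
     quotient_module K (free_module K (carrier M \<times> carrier N)) (tensor_null K M N)"

definition pure_tensor ::
  "'k ring \<Rightarrow> ('k, 'm) module \<Rightarrow> ('k, 'n) module \<Rightarrow> 'm \<Rightarrow> 'n \<Rightarrow> ('m \<times> 'n \<Rightarrow> 'k) set" where
  "pure_tensor K M N m n =
     tensor_null K M N +>\<^bsub>free_module K (carrier M \<times> carrier N)\<^esub> free_gen K (m, n)"

text \<open>
  The linear map induced by a bilinear map \<open>b\<close> into \<open>P\<close>. By bilinearity of \<open>b\<close> the value does not
  depend on the chosen representative, see \<open>two_modules.tensor_lift_pure\<close> and
  \<open>two_modules.tensor_lift_linear\<close>.
\<close>

definition tensor_lift ::
  "'k ring \<Rightarrow> ('k, 'p) module \<Rightarrow> ('m \<Rightarrow> 'n \<Rightarrow> 'p) \<Rightarrow> ('m \<times> 'n \<Rightarrow> 'k) set \<Rightarrow> 'p" where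
  "tensor_lift K P b C =
     (let f = (SOME f. f \<in> C) in
        finsum P (\<lambda>p. f p \<odot>\<^bsub>P\<^esub> b (fst p) (snd p)) {p. f p \<noteq> \<zero>\<^bsub>K\<^esub>})"

text \<open>\<open>f \<otimes> g\<close> for \<open>f\<close> with codomain \<open>P\<close> and \<open>g\<close> with codomain \<open>Q\<close>.\<close>

definition tensor_map ::
  "'k ring \<Rightarrow> ('k, 'p) module \<Rightarrow> ('k, 'q) module \<Rightarrow> ('m \<Rightarrow> 'p) \<Rightarrow> ('n \<Rightarrow> 'q)
    \<Rightarrow> ('m \<times> 'n \<Rightarrow> 'k) set \<Rightarrow> ('p \<times> 'q \<Rightarrow> 'k) set" where
  "tensor_map K P Q f g = tensor_lift K (P \<boxtimes>\<^bsub>K\<^esub> Q) (\<lambda>m n. pure_tensor K P Q (f m) (g n))"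

text \<open>The associators \<open>(L \<otimes> M) \<otimes> N \<rightarrow> L \<otimes> (M \<otimes> N)\<close> and \<open>L \<otimes> (M \<otimes> N) \<rightarrow> (L \<otimes> M) \<otimes> N\<close>.\<close>

definition tensor_assoc ::
  "'k ring \<Rightarrow> ('k, 'l) module \<Rightarrow> ('k, 'm) module \<Rightarrow> ('k, 'n) module
    \<Rightarrow> (('l \<times> 'm \<Rightarrow> 'k) set \<times> 'n \<Rightarrow> 'k) set \<Rightarrow> ('l \<times> ('m \<times> 'n \<Rightarrow> 'k) set \<Rightarrow> 'k) set" where
  "tensor_assoc K L M N =
     tensor_lift K (L \<boxtimes>\<^bsub>K\<^esub> (M \<boxtimes>\<^bsub>K\<^esub> N)) (\<lambda>t n.
       tensor_lift K (L \<boxtimes>\<^bsub>K\<^esub> (M \<boxtimes>\<^bsub>K\<^esub> N)) (\<lambda>l m.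
         pure_tensor K L (M \<boxtimes>\<^bsub>K\<^esub> N) l (pure_tensor K M N m n)) t)"

definition tensor_unassoc ::
  "'k ring \<Rightarrow> ('k, 'l) module \<Rightarrow> ('k, 'm) module \<Rightarrow> ('k, 'n) module
    \<Rightarrow> ('l \<times> ('m \<times> 'n \<Rightarrow> 'k) set \<Rightarrow> 'k) set \<Rightarrow> (('l \<times> 'm \<Rightarrow> 'k) set \<times> 'n \<Rightarrow> 'k) set" where
  "tensor_unassoc K L M N =
     tensor_lift K ((L \<boxtimes>\<^bsub>K\<^esub> M) \<boxtimes>\<^bsub>K\<^esub> N) (\<lambda>l.
       tensor_lift K ((L \<boxtimes>\<^bsub>K\<^esub> M) \<boxtimes>\<^bsub>K\<^esub> N) (\<lambda>m n.
         pure_tensor K (L \<boxtimes>\<^bsub>K\<^esub> M) N (pure_tensor K L M l m) n))"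


subsection \<open>The universal property\<close>

lemma free_module_module:
  assumes "cring K" shows "module K (free_module K U)"
proof -
  interpret K: cring K by fact
  let ?F = "free_module K U"
  have add: "f \<oplus>\<^bsub>?F\<^esub> g \<in> carrier ?F" if "f \<in> carrier ?F" "g \<in> carrier ?F" for f g
  proof -
    have "finite ({p. f p \<noteq> \<zero>\<^bsub>K\<^esub>} \<union> {p. g p \<noteq> \<zero>\<^bsub>K\<^esub>})" using that by (simp add: free_module_def)
    moreover have "{p. f p \<oplus>\<^bsub>K\<^esub> g p \<noteq> \<zero>\<^bsub>K\<^esub>} \<subseteq> {p. f p \<noteq> \<zero>\<^bsub>K\<^esub>} \<union> {p. g p \<noteq> \<zero>\<^bsub>K\<^esub>}" by auto
    ultimately have "finite {p. f p \<oplus>\<^bsub>K\<^esub> g p \<noteq> \<zero>\<^bsub>K\<^esub>}" by (rule rev_finite_subset)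
    thus ?thesis using that by (simp add: free_module_def)
  qed
  have smult: "c \<odot>\<^bsub>?F\<^esub> f \<in> carrier ?F" if "c \<in> carrier K" "f \<in> carrier ?F" for c f
  proof -
    have "finite {p. f p \<noteq> \<zero>\<^bsub>K\<^esub>}" using that by (simp add: free_module_def)
    moreover have "{p. c \<otimes>\<^bsub>K\<^esub> f p \<noteq> \<zero>\<^bsub>K\<^esub>} \<subseteq> {p. f p \<noteq> \<zero>\<^bsub>K\<^esub>}" using that by auto
    ultimately have "finite {p. c \<otimes>\<^bsub>K\<^esub> f p \<noteq> \<zero>\<^bsub>K\<^esub>}" by (rule rev_finite_subset)
    thus ?thesis using that by (simp add: free_module_def)
  qed
  show ?thesis
  proof (rule moduleI)
    show "abelian_group ?F"
    proof (rule abelian_groupI)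
      fix f assume f: "f \<in> carrier ?F"
      have "(\<lambda>p. \<ominus>\<^bsub>K\<^esub> \<one>\<^bsub>K\<^esub> \<otimes>\<^bsub>K\<^esub> f p) \<in> carrier ?F"
        using smult[of "\<ominus>\<^bsub>K\<^esub> \<one>\<^bsub>K\<^esub>" f] f by (simp add: free_module_def)
      moreover have "(\<lambda>p. \<ominus>\<^bsub>K\<^esub> \<one>\<^bsub>K\<^esub> \<otimes>\<^bsub>K\<^esub> f p) \<oplus>\<^bsub>?F\<^esub> f = \<zero>\<^bsub>?F\<^esub>"
        using f by (simp add: free_module_def K.l_minus K.l_neg)
      ultimately show "\<exists>g\<in>carrier ?F. g \<oplus>\<^bsub>?F\<^esub> f = \<zero>\<^bsub>?F\<^esub>" by blast
    qed (use add in \<open>auto simp: free_module_def K.a_ac fun_eq_iff\<close>)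
  qed (use assms smult in \<open>auto simp: free_module_def K.l_distr K.r_distr K.m_assoc fun_eq_iff\<close>)
qed

lemma submodule_span_submodule:
  assumes "module K M" "S \<subseteq> carrier M"
  shows "submodule (submodule_span K M S) K M" "S \<subseteq> submodule_span K M S"
proof -
  interpret M: module K M by fact
  have c: "carrier M \<in> {H. submodule H K M \<and> S \<subseteq> H}"
    using M.carrier_is_submodule assms by auto
  show "submodule (submodule_span K M S) K M"
  proof (rule M.submoduleI)
    show "submodule_span K M S \<subseteq> carrier M" using c by (auto simp: submodule_span_def)
  qed (auto simp: submodule_span_def M.submoduleE dest!: submodule.axioms(1) dest: subgroup.one_closed)
  show "S \<subseteq> submodule_span K M S" by (auto simp: submodule_span_def)
qed

locale module_quotient = M: module K M + H: submodule H K M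
  for K :: "'k ring" and M :: "('k, 'm) module" and H
begin

sublocale Q: abelian_subgroup H M
  by (rule abelian_subgroupI3[OF additive_subgroup.intro[OF H.subgroup_axioms] M.abelian_group_axioms])

lemma quotient_carrier: "carrier (quotient_module K M H) = (\<lambda>x. H +>\<^bsub>M\<^esub> x) ` carrier M"
  by (auto simp: quotient_module_def A_RCOSETS_def')

lemma quotient_zero: "\<zero>\<^bsub>quotient_module K M H\<^esub> = H +>\<^bsub>M\<^esub> \<zero>\<^bsub>M\<^esub>"
  by (simp add: quotient_module_def M.a_coset_add_zero[OF Q.a_subset])

lemma quotient_add:
  assumes "x \<in> carrier M" "y \<in> carrier M"
  shows "(H +>\<^bsub>M\<^esub> x) \<oplus>\<^bsub>quotient_module K M H\<^esub> (H +>\<^bsub>M\<^esub> y) = H +>\<^bsub>M\<^esub> (x \<oplus>\<^bsub>M\<^esub> y)"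
  using assms by (simp add: quotient_module_def Q.a_rcos_sum)

lemma quotient_smult:
  assumes "c \<in> carrier K" "x \<in> carrier M"
  shows "c \<odot>\<^bsub>quotient_module K M H\<^esub> (H +>\<^bsub>M\<^esub> x) = H +>\<^bsub>M\<^esub> (c \<odot>\<^bsub>M\<^esub> x)"
proof -
  have *: "h' \<oplus>\<^bsub>M\<^esub> c \<odot>\<^bsub>M\<^esub> (h \<oplus>\<^bsub>M\<^esub> x) = (h' \<oplus>\<^bsub>M\<^esub> c \<odot>\<^bsub>M\<^esub> h) \<oplus>\<^bsub>M\<^esub> c \<odot>\<^bsub>M\<^esub> x" if "h \<in> H" "h' \<in> H" for h h'
    using assms that[THEN Q.a_Hcarr] by (simp add: M.smult_r_distr M.a_assoc)
  have c: "h' \<oplus>\<^bsub>M\<^esub> c \<odot>\<^bsub>M\<^esub> h \<in> H" if "h \<in> H" "h' \<in> H" for h h'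
    by (intro Q.a_closed H.smult_closed assms that)
  have x: "h \<oplus>\<^bsub>M\<^esub> c \<odot>\<^bsub>M\<^esub> x \<in> H <+>\<^bsub>M\<^esub> ((\<lambda>x. c \<odot>\<^bsub>M\<^esub> x) ` (H +>\<^bsub>M\<^esub> x))" if "h \<in> H" for h
  proof -
    have "x \<in> H +>\<^bsub>M\<^esub> x" by (rule Q.a_rcos_self[OF assms(2)])
    thus ?thesis unfolding set_add_def' using that by blast
  qed
  have "H <+>\<^bsub>M\<^esub> ((\<lambda>x. c \<odot>\<^bsub>M\<^esub> x) ` (H +>\<^bsub>M\<^esub> x)) = H +>\<^bsub>M\<^esub> (c \<odot>\<^bsub>M\<^esub> x)"
  proof (intro equalityI subsetI)
    fix y assume "y \<in> H <+>\<^bsub>M\<^esub> ((\<lambda>x. c \<odot>\<^bsub>M\<^esub> x) ` (H +>\<^bsub>M\<^esub> x))"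
    then obtain h h' where "h \<in> H" "h' \<in> H" "y = h' \<oplus>\<^bsub>M\<^esub> c \<odot>\<^bsub>M\<^esub> (h \<oplus>\<^bsub>M\<^esub> x)"
      unfolding a_r_coset_def' set_add_def' by blast
    hence "h' \<oplus>\<^bsub>M\<^esub> c \<odot>\<^bsub>M\<^esub> h \<in> H" "y = (h' \<oplus>\<^bsub>M\<^esub> c \<odot>\<^bsub>M\<^esub> h) \<oplus>\<^bsub>M\<^esub> c \<odot>\<^bsub>M\<^esub> x"
      using c * by simp_all
    thus "y \<in> H +>\<^bsub>M\<^esub> (c \<odot>\<^bsub>M\<^esub> x)" unfolding a_r_coset_def' by blast
  next
    fix y assume "y \<in> H +>\<^bsub>M\<^esub> (c \<odot>\<^bsub>M\<^esub> x)"
    then obtain h where "h \<in> H" "y = h \<oplus>\<^bsub>M\<^esub> c \<odot>\<^bsub>M\<^esub> x" unfolding a_r_coset_def' by blast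
    with x show "y \<in> H <+>\<^bsub>M\<^esub> ((\<lambda>x. c \<odot>\<^bsub>M\<^esub> x) ` (H +>\<^bsub>M\<^esub> x))" by simp
  qed
  thus ?thesis by (simp add: quotient_module_def)
qed

lemma quotient_module_module: "module K (quotient_module K M H)"
proof -
  note simps = quotient_add quotient_smult quotient_zero
  have E: thesis if "C \<in> carrier (quotient_module K M H)"
      "\<And>x. x \<in> carrier M \<Longrightarrow> C = H +>\<^bsub>M\<^esub> x \<Longrightarrow> thesis" for C thesis
    using that by (auto simp: quotient_carrier)
  have I: "H +>\<^bsub>M\<^esub> x \<in> carrier (quotient_module K M H)" if "x \<in> carrier M" for x
    using that by (simp add: quotient_carrier)
  show ?thesis
  proof (rule moduleI)
    show "cring K" by (rule module.axioms(1)[OF M.module_axioms])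
    show "abelian_group (quotient_module K M H)"
    proof (rule abelian_groupI)
      fix C assume "C \<in> carrier (quotient_module K M H)"
      then obtain x where x: "x \<in> carrier M" "C = H +>\<^bsub>M\<^esub> x" by (rule E)
      hence "(H +>\<^bsub>M\<^esub> (\<ominus>\<^bsub>M\<^esub> x)) \<oplus>\<^bsub>quotient_module K M H\<^esub> C = \<zero>\<^bsub>quotient_module K M H\<^esub>"
        by (simp add: simps M.l_neg)
      with x show "\<exists>D\<in>carrier (quotient_module K M H).
          D \<oplus>\<^bsub>quotient_module K M H\<^esub> C = \<zero>\<^bsub>quotient_module K M H\<^esub>"
        by (intro bexI[of _ "H +>\<^bsub>M\<^esub> (\<ominus>\<^bsub>M\<^esub> x)"] I) simp_all
      show "\<zero>\<^bsub>quotient_module K M H\<^esub> \<oplus>\<^bsub>quotient_module K M H\<^esub> C = C"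
        using x by (simp add: simps)
    next
      fix C D assume "C \<in> carrier (quotient_module K M H)" "D \<in> carrier (quotient_module K M H)"
      then obtain x y where x: "x \<in> carrier M" "C = H +>\<^bsub>M\<^esub> x" and y: "y \<in> carrier M" "D = H +>\<^bsub>M\<^esub> y"
        by (elim E)
      show "C \<oplus>\<^bsub>quotient_module K M H\<^esub> D \<in> carrier (quotient_module K M H)"
        using x y by (simp add: simps I)
      show "C \<oplus>\<^bsub>quotient_module K M H\<^esub> D = D \<oplus>\<^bsub>quotient_module K M H\<^esub> C"
        using x y by (simp add: simps M.a_comm)
      fix B assume "B \<in> carrier (quotient_module K M H)"
      then obtain z where "z \<in> carrier M" "B = H +>\<^bsub>M\<^esub> z" by (rule E)
      thus "C \<oplus>\<^bsub>quotient_module K M H\<^esub> D \<oplus>\<^bsub>quotient_module K M H\<^esub> B =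
          C \<oplus>\<^bsub>quotient_module K M H\<^esub> (D \<oplus>\<^bsub>quotient_module K M H\<^esub> B)"
        using x y by (simp add: simps M.a_assoc)
    qed (simp add: quotient_zero I)
  next
    fix c C assume c: "c \<in> carrier K" and "C \<in> carrier (quotient_module K M H)"
    then obtain x where x: "x \<in> carrier M" "C = H +>\<^bsub>M\<^esub> x" by (elim E)
    show "c \<odot>\<^bsub>quotient_module K M H\<^esub> C \<in> carrier (quotient_module K M H)"
      using c x by (simp add: simps I)
    fix d assume d: "d \<in> carrier K"
    show "(c \<oplus>\<^bsub>K\<^esub> d) \<odot>\<^bsub>quotient_module K M H\<^esub> C =
        c \<odot>\<^bsub>quotient_module K M H\<^esub> C \<oplus>\<^bsub>quotient_module K M H\<^esub> d \<odot>\<^bsub>quotient_module K M H\<^esub> C"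
      using c d x by (simp add: simps M.smult_l_distr)
    show "(c \<otimes>\<^bsub>K\<^esub> d) \<odot>\<^bsub>quotient_module K M H\<^esub> C =
        c \<odot>\<^bsub>quotient_module K M H\<^esub> (d \<odot>\<^bsub>quotient_module K M H\<^esub> C)"
      using c d x by (simp add: simps M.smult_assoc1)
  next
    fix c C D assume c: "c \<in> carrier K" and "C \<in> carrier (quotient_module K M H)" "D \<in> carrier (quotient_module K M H)"
    then obtain x y where x: "x \<in> carrier M" "C = H +>\<^bsub>M\<^esub> x" and y: "y \<in> carrier M" "D = H +>\<^bsub>M\<^esub> y"
      by (elim E)
    show "c \<odot>\<^bsub>quotient_module K M H\<^esub> (C \<oplus>\<^bsub>quotient_module K M H\<^esub> D) =
        c \<odot>\<^bsub>quotient_module K M H\<^esub> C \<oplus>\<^bsub>quotient_module K M H\<^esub> c \<odot>\<^bsub>quotient_module K M H\<^esub> D"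
      using c x y by (simp add: simps M.smult_r_distr)
  next
    fix C assume "C \<in> carrier (quotient_module K M H)"
    then obtain x where "x \<in> carrier M" "C = H +>\<^bsub>M\<^esub> x" by (rule E)
    thus "\<one>\<^bsub>K\<^esub> \<odot>\<^bsub>quotient_module K M H\<^esub> C = C" by (simp add: simps)
  qed
qed

end

lemma free_gen_closed:
  assumes "cring K" "x \<in> U" shows "free_gen K x \<in> carrier (free_module K U)"
proof -
  interpret cring K by fact
  have "{p. free_gen K x p \<noteq> \<zero>\<^bsub>K\<^esub>} \<subseteq> {x}" by (auto simp: free_gen_def)
  hence "finite {p. free_gen K x p \<noteq> \<zero>\<^bsub>K\<^esub>}" by (rule finite_subset) simp
  thus ?thesis using assms by (auto simp: free_module_def free_gen_def)
qed

lemma free_module_induct: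
  assumes "cring K" "submodule H K (free_module K U)" "\<And>x. x \<in> U \<Longrightarrow> free_gen K x \<in> H"
    and "f \<in> carrier (free_module K U)"
  shows "f \<in> H"
proof -
  interpret cring K by fact
  interpret F: module K "free_module K U" by (rule free_module_module) fact
  note H = F.submoduleE[OF assms(2)]
  have "finite {p. f p \<noteq> \<zero>\<^bsub>K\<^esub>}" using assms(4) by (simp add: free_module_def)
  then show ?thesis using assms(4)
  proof (induction "{p. f p \<noteq> \<zero>\<^bsub>K\<^esub>}" arbitrary: f rule: finite_induct)
    case empty
    hence "f = \<zero>\<^bsub>free_module K U\<^esub>" by (auto simp: free_module_def)
    moreover have "\<zero>\<^bsub>free_module K U\<^esub> \<in> H"
      using subgroup.one_closed[OF submodule.axioms(1)[OF assms(2)]] by simp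
    ultimately show ?case by simp
  next
    case (insert x S)
    let ?g = "f(x := \<zero>\<^bsub>K\<^esub>)"
    have S: "S = {p. ?g p \<noteq> \<zero>\<^bsub>K\<^esub>}" using insert by auto
    have f: "f p \<in> carrier K" "p \<notin> U \<Longrightarrow> f p = \<zero>\<^bsub>K\<^esub>" for p
      using insert.prems by (auto simp: free_module_def)
    have "finite {p. ?g p \<noteq> \<zero>\<^bsub>K\<^esub>}" using \<open>finite S\<close> S by simp
    hence "?g \<in> carrier (free_module K U)" using f unfolding free_module_def by auto
    with insert.hyps(3)[OF S] have g: "?g \<in> H" .
    have x: "x \<in> U" using insert f by blast
    have "f x \<odot>\<^bsub>free_module K U\<^esub> free_gen K x \<in> H" using H(4) f assms(3) x by blast
    with g have "?g \<oplus>\<^bsub>free_module K U\<^esub> (f x \<odot>\<^bsub>free_module K U\<^esub> free_gen K x) \<in> H" using H(5) by blast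
    moreover have "?g \<oplus>\<^bsub>free_module K U\<^esub> (f x \<odot>\<^bsub>free_module K U\<^esub> free_gen K x) = f"
      using f by (auto simp: free_module_def free_gen_def fun_eq_iff)
    ultimately show ?case by simp
  qed
qed

definition lin_ext :: "'k ring \<Rightarrow> ('k, 'p) module \<Rightarrow> ('x \<Rightarrow> 'p) \<Rightarrow> ('x \<Rightarrow> 'k) \<Rightarrow> 'p" where
  "lin_ext K P b f = finsum P (\<lambda>p. f p \<odot>\<^bsub>P\<^esub> b p) {p. f p \<noteq> \<zero>\<^bsub>K\<^esub>}"

lemma lin_ext_superset:
  assumes "module K P" "b \<in> U \<rightarrow> carrier P" "f \<in> carrier (free_module K U)"
    and "finite T" "{p. f p \<noteq> \<zero>\<^bsub>K\<^esub>} \<subseteq> T" "T \<subseteq> U"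
  shows "lin_ext K P b f = finsum P (\<lambda>p. f p \<odot>\<^bsub>P\<^esub> b p) T"
proof -
  interpret P: module K P by fact
  have f: "f p \<in> carrier K" for p using assms(3) by (auto simp: free_module_def)
  show ?thesis unfolding lin_ext_def
    by (rule P.add.finprod_mono_neutral_cong_left)
       (use assms f in \<open>auto simp: Pi_def subset_eq\<close>)
qed

lemma lin_ext_linear:
  assumes "module K P" "b \<in> U \<rightarrow> carrier P"
  shows "lin_ext K P b \<in> linear_maps K (free_module K U) P"
proof -
  interpret P: module K P by fact
  interpret F: module K "free_module K U" by (rule free_module_module) (rule module.axioms(1)[OF assms(1)])
  let ?F = "free_module K U"
  have U: "{p. f p \<noteq> \<zero>\<^bsub>K\<^esub>} \<subseteq> U" "finite {p. f p \<noteq> \<zero>\<^bsub>K\<^esub>}" "f p \<in> carrier K"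
    if "f \<in> carrier ?F" for f p using that by (auto simp: free_module_def)
  have term_closed: "f p \<odot>\<^bsub>P\<^esub> b p \<in> carrier P" if "f \<in> carrier ?F" "p \<in> U" for f p
    using that U(3) assms(2) by blast
  show ?thesis unfolding linear_maps_def
  proof (intro CollectI conjI ballI Pi_I)
    fix f assume f: "f \<in> carrier ?F"
    show "lin_ext K P b f \<in> carrier P" unfolding lin_ext_def
      by (rule P.finsum_closed) (use U(1)[OF f] term_closed[OF f] in auto)
    fix c assume c: "c \<in> carrier K"
    let ?T = "{p. f p \<noteq> \<zero>\<^bsub>K\<^esub>}"
    have cf: "(c \<odot>\<^bsub>?F\<^esub> f) p = c \<otimes>\<^bsub>K\<^esub> f p" for p by (simp add: free_module_def)
    have "lin_ext K P b (c \<odot>\<^bsub>?F\<^esub> f) = finsum P (\<lambda>p. (c \<odot>\<^bsub>?F\<^esub> f) p \<odot>\<^bsub>P\<^esub> b p) ?T"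
      using c f U[OF f] by (intro lin_ext_superset[OF assms]) (auto simp: cf)
    also have "\<dots> = finsum P (\<lambda>p. c \<odot>\<^bsub>P\<^esub> (f p \<odot>\<^bsub>P\<^esub> b p)) ?T"
      by (rule P.finsum_cong') (use c U[OF f] assms(2) in \<open>auto simp: cf P.smult_assoc1 Pi_def subset_eq\<close>)
    also have "\<dots> = c \<odot>\<^bsub>P\<^esub> lin_ext K P b f" unfolding lin_ext_def
      by (rule P.finsum_smult_ldistr[symmetric]) (use c U[OF f] term_closed[OF f] in auto)
    finally show "lin_ext K P b (c \<odot>\<^bsub>?F\<^esub> f) = c \<odot>\<^bsub>P\<^esub> lin_ext K P b f" .
  next
    fix f g assume f: "f \<in> carrier ?F" and g: "g \<in> carrier ?F"
    let ?T = "{p. f p \<noteq> \<zero>\<^bsub>K\<^esub>} \<union> {p. g p \<noteq> \<zero>\<^bsub>K\<^esub>}"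
    have T: "finite ?T" "?T \<subseteq> U" using U f g by auto
    have fg: "(f \<oplus>\<^bsub>?F\<^esub> g) p = f p \<oplus>\<^bsub>K\<^esub> g p" for p by (simp add: free_module_def)
    have "lin_ext K P b (f \<oplus>\<^bsub>?F\<^esub> g) = finsum P (\<lambda>p. (f \<oplus>\<^bsub>?F\<^esub> g) p \<odot>\<^bsub>P\<^esub> b p) ?T"
      using f g T by (intro lin_ext_superset[OF assms]) (auto simp: fg)
    also have "\<dots> = finsum P (\<lambda>p. f p \<odot>\<^bsub>P\<^esub> b p \<oplus>\<^bsub>P\<^esub> g p \<odot>\<^bsub>P\<^esub> b p) ?T"
      by (rule P.finsum_cong') (use T U(3)[OF f] U(3)[OF g] assms(2) term_closed f g in
          \<open>auto simp: fg P.smult_l_distr Pi_def subset_eq\<close>)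
    also have "\<dots> = finsum P (\<lambda>p. f p \<odot>\<^bsub>P\<^esub> b p) ?T \<oplus>\<^bsub>P\<^esub> finsum P (\<lambda>p. g p \<odot>\<^bsub>P\<^esub> b p) ?T"
      by (rule P.finsum_addf) (use T term_closed f g in \<open>auto simp: subset_eq\<close>)
    also have "finsum P (\<lambda>p. f p \<odot>\<^bsub>P\<^esub> b p) ?T = lin_ext K P b f"
      using f T by (intro lin_ext_superset[OF assms, symmetric]) auto
    also have "finsum P (\<lambda>p. g p \<odot>\<^bsub>P\<^esub> b p) ?T = lin_ext K P b g"
      using g T by (intro lin_ext_superset[OF assms, symmetric]) auto
    finally show "lin_ext K P b (f \<oplus>\<^bsub>?F\<^esub> g) = lin_ext K P b f \<oplus>\<^bsub>P\<^esub> lin_ext K P b g" .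
  qed
qed

lemma lin_ext_gen:
  assumes "module K P" "b \<in> U \<rightarrow> carrier P" "x \<in> U"
  shows "lin_ext K P b (free_gen K x) = b x"
proof -
  interpret P: module K P by fact
  have K: "cring K" by (rule module.axioms(1)[OF assms(1)])
  have "lin_ext K P b (free_gen K x) = finsum P (\<lambda>p. free_gen K x p \<odot>\<^bsub>P\<^esub> b p) {x}"
    using assms by (intro lin_ext_superset[OF assms(1,2)] free_gen_closed[OF K]) (auto simp: free_gen_def)
  also have "\<dots> = b x"
    using assms by (auto simp: free_gen_def Pi_def)
  finally show ?thesis .
qed

lemma linear_maps_closed: "f \<in> linear_maps K M N \<Longrightarrow> x \<in> carrier M \<Longrightarrow> f x \<in> carrier N"
  and linear_maps_add: "f \<in> linear_maps K M N \<Longrightarrow> x \<in> carrier M \<Longrightarrow> y \<in> carrier M \<Longrightarrow>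
    f (x \<oplus>\<^bsub>M\<^esub> y) = f x \<oplus>\<^bsub>N\<^esub> f y"
  and linear_maps_smult: "f \<in> linear_maps K M N \<Longrightarrow> c \<in> carrier K \<Longrightarrow> x \<in> carrier M \<Longrightarrow>
    f (c \<odot>\<^bsub>M\<^esub> x) = c \<odot>\<^bsub>N\<^esub> f x"
  by (auto simp: linear_maps_def)

lemma equalizer_submodule:
  assumes "module K M" "module K N" "f \<in> linear_maps K M N" "g \<in> linear_maps K M N"
  shows "submodule {x \<in> carrier M. f x = g x} K M"
proof -
  interpret M: module K M by fact
  interpret N: module K N by fact
  have z: "h \<zero>\<^bsub>M\<^esub> = \<zero>\<^bsub>N\<^esub>" if "h \<in> linear_maps K M N" for h
    using linear_maps_smult[OF that, of "\<zero>\<^bsub>K\<^esub>" "\<zero>\<^bsub>M\<^esub>"] linear_maps_closed[OF that, of "\<zero>\<^bsub>M\<^esub>"] by simp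
  have n: "h (\<ominus>\<^bsub>M\<^esub> x) = (\<ominus>\<^bsub>K\<^esub> \<one>\<^bsub>K\<^esub>) \<odot>\<^bsub>N\<^esub> h x" if "h \<in> linear_maps K M N" "x \<in> carrier M" for h x
    using linear_maps_smult[OF that(1), of "\<ominus>\<^bsub>K\<^esub> \<one>\<^bsub>K\<^esub>" x] that by (simp add: M.smult_l_minus)
  show ?thesis
    by (rule M.submoduleI)
       (use assms z[OF assms(3)] z[OF assms(4)] n[OF assms(3)] n[OF assms(4)] in \<open>auto simp: linear_maps_add[of _ K M N] linear_maps_smult[of _ K M N]\<close>)
qed

definition bilinear_map ::
  "'k ring \<Rightarrow> ('k, 'm) module \<Rightarrow> ('k, 'n) module \<Rightarrow> ('k, 'p) module \<Rightarrow> ('m \<Rightarrow> 'n \<Rightarrow> 'p) \<Rightarrow> bool" where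
  "bilinear_map K M N P b \<longleftrightarrow>
     (\<forall>m\<in>carrier M. b m \<in> linear_maps K N P) \<and>
     (\<forall>n\<in>carrier N. (\<lambda>m. b m n) \<in> linear_maps K M P)"

lemma bilinear_mapD:
  assumes "bilinear_map K M N P b"
  shows "m \<in> carrier M \<Longrightarrow> n \<in> carrier N \<Longrightarrow> b m n \<in> carrier P"
    "m \<in> carrier M \<Longrightarrow> m' \<in> carrier M \<Longrightarrow> n \<in> carrier N \<Longrightarrow> b (m \<oplus>\<^bsub>M\<^esub> m') n = b m n \<oplus>\<^bsub>P\<^esub> b m' n"
    "m \<in> carrier M \<Longrightarrow> n \<in> carrier N \<Longrightarrow> n' \<in> carrier N \<Longrightarrow> b m (n \<oplus>\<^bsub>N\<^esub> n') = b m n \<oplus>\<^bsub>P\<^esub> b m n'"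
    "c \<in> carrier K \<Longrightarrow> m \<in> carrier M \<Longrightarrow> n \<in> carrier N \<Longrightarrow> b (c \<odot>\<^bsub>M\<^esub> m) n = c \<odot>\<^bsub>P\<^esub> b m n"
    "c \<in> carrier K \<Longrightarrow> m \<in> carrier M \<Longrightarrow> n \<in> carrier N \<Longrightarrow> b m (c \<odot>\<^bsub>N\<^esub> n) = c \<odot>\<^bsub>P\<^esub> b m n"
  using assms by (auto simp: bilinear_map_def linear_maps_def)

locale two_modules = M: module K M + N: module K N
  for K :: "'k ring" and M :: "('k, 'm) module" and N :: "('k, 'n) module"
begin

abbreviation "F \<equiv> free_module K (carrier M \<times> carrier N)"
abbreviation "Z \<equiv> tensor_null K M N"

sublocale F: module K F
  by (rule free_module_module) (rule module.axioms(1)[OF M.module_axioms])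

lemma gen_closed: "m \<in> carrier M \<Longrightarrow> n \<in> carrier N \<Longrightarrow> free_gen K (m, n) \<in> carrier F"
  by (rule free_gen_closed[OF module.axioms(1)[OF M.module_axioms]]) simp

lemma relations_closed: "bilinear_relations K M N \<subseteq> carrier F"
  unfolding bilinear_relations_def Let_def using gen_closed by (auto intro!: F.minus_closed)

sublocale T: module_quotient K F Z
proof -
  show "module_quotient K F Z"
    unfolding tensor_null_def module_quotient_def
    using submodule_span_submodule[OF F.module_axioms relations_closed] F.module_axioms by blast
qed

lemma tensor_product_module: "module K (M \<boxtimes>\<^bsub>K\<^esub> N)"
  using T.quotient_module_module by (simp add: tensor_product_def)

lemma pure_tensor_closed:
  "m \<in> carrier M \<Longrightarrow> n \<in> carrier N \<Longrightarrow> pure_tensor K M N m n \<in> carrier (M \<boxtimes>\<^bsub>K\<^esub> N)"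
  by (simp add: pure_tensor_def tensor_product_def T.quotient_carrier gen_closed)

lemma relations_null: "r \<in> bilinear_relations K M N \<Longrightarrow> r \<in> Z"
  using submodule_span_submodule(2)[OF F.module_axioms relations_closed]
  by (auto simp: tensor_null_def)

lemma coset_eqI:
  assumes "x \<in> carrier F" "y \<in> carrier F" "x \<ominus>\<^bsub>F\<^esub> y \<in> Z"
  shows "Z +>\<^bsub>F\<^esub> x = Z +>\<^bsub>F\<^esub> y"
  using T.Q.a_rcos_module[of y x] T.Q.a_repr_independence'[of x y] assms by (simp add: F.minus_eq)

lemma pure_tensor_bilinear: "bilinear_map K M N (M \<boxtimes>\<^bsub>K\<^esub> N) (pure_tensor K M N)"
proof -
  let ?g = "\<lambda>m n. free_gen K (m, n)"
  note simps = pure_tensor_def tensor_product_def T.quotient_add T.quotient_smult gen_closed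
  have "pure_tensor K M N m (n \<oplus>\<^bsub>N\<^esub> n') =
      pure_tensor K M N m n \<oplus>\<^bsub>M \<boxtimes>\<^bsub>K\<^esub> N\<^esub> pure_tensor K M N m n'"
    if "m \<in> carrier M" "n \<in> carrier N" "n' \<in> carrier N" for m n n'
  proof -
    have "?g m (n \<oplus>\<^bsub>N\<^esub> n') \<ominus>\<^bsub>F\<^esub> (?g m n \<oplus>\<^bsub>F\<^esub> ?g m n') \<in> bilinear_relations K M N"
      unfolding bilinear_relations_def Let_def using that by blast
    from coset_eqI[OF _ _ relations_null[OF this]] that show ?thesis by (simp add: simps)
  qed
  moreover have "pure_tensor K M N (m \<oplus>\<^bsub>M\<^esub> m') n =
      pure_tensor K M N m n \<oplus>\<^bsub>M \<boxtimes>\<^bsub>K\<^esub> N\<^esub> pure_tensor K M N m' n"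
    if "m \<in> carrier M" "m' \<in> carrier M" "n \<in> carrier N" for m m' n
  proof -
    have "?g (m \<oplus>\<^bsub>M\<^esub> m') n \<ominus>\<^bsub>F\<^esub> (?g m n \<oplus>\<^bsub>F\<^esub> ?g m' n) \<in> bilinear_relations K M N"
      unfolding bilinear_relations_def Let_def using that by blast
    from coset_eqI[OF _ _ relations_null[OF this]] that show ?thesis by (simp add: simps)
  qed
  moreover have "pure_tensor K M N (c \<odot>\<^bsub>M\<^esub> m) n = c \<odot>\<^bsub>M \<boxtimes>\<^bsub>K\<^esub> N\<^esub> pure_tensor K M N m n"
    if "c \<in> carrier K" "m \<in> carrier M" "n \<in> carrier N" for c m n
  proof -
    have "?g (c \<odot>\<^bsub>M\<^esub> m) n \<ominus>\<^bsub>F\<^esub> (c \<odot>\<^bsub>F\<^esub> ?g m n) \<in> bilinear_relations K M N"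
      unfolding bilinear_relations_def Let_def using that by blast
    from coset_eqI[OF _ _ relations_null[OF this]] that show ?thesis by (simp add: simps)
  qed
  moreover have "pure_tensor K M N m (c \<odot>\<^bsub>N\<^esub> n) = c \<odot>\<^bsub>M \<boxtimes>\<^bsub>K\<^esub> N\<^esub> pure_tensor K M N m n"
    if "c \<in> carrier K" "m \<in> carrier M" "n \<in> carrier N" for c m n
  proof -
    have "?g m (c \<odot>\<^bsub>N\<^esub> n) \<ominus>\<^bsub>F\<^esub> (c \<odot>\<^bsub>F\<^esub> ?g m n) \<in> bilinear_relations K M N"
      unfolding bilinear_relations_def Let_def using that by blast
    from coset_eqI[OF _ _ relations_null[OF this]] that show ?thesis by (simp add: simps)
  qed
  ultimately show ?thesis
    unfolding bilinear_map_def linear_maps_def by (simp add: pure_tensor_closed Pi_def)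
qed

lemma proj_linear: "(\<lambda>f. Z +>\<^bsub>F\<^esub> f) \<in> linear_maps K F (M \<boxtimes>\<^bsub>K\<^esub> N)"
  unfolding linear_maps_def
  by (simp add: tensor_product_def T.quotient_carrier T.quotient_add T.quotient_smult)

lemma tensor_lift_coset:
  assumes "module K P" "bilinear_map K M N P b" "f \<in> carrier F"
  shows "tensor_lift K P b (Z +>\<^bsub>F\<^esub> f) = lin_ext K P (\<lambda>p. b (fst p) (snd p)) f"
proof -
  interpret P: module K P by fact
  let ?b = "\<lambda>p. b (fst p) (snd p)"
  let ?l = "lin_ext K P ?b"
  have b: "?b \<in> carrier M \<times> carrier N \<rightarrow> carrier P"
    using bilinear_mapD(1)[OF assms(2)] by auto
  have l: "?l \<in> linear_maps K F P" by (rule lin_ext_linear[OF assms(1) b])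
  have gen: "?l (free_gen K (m, n)) = b m n" if "m \<in> carrier M" "n \<in> carrier N" for m n
    using lin_ext_gen[OF assms(1) b, of "(m, n)"] that by simp
  have zero: "(\<lambda>_. \<zero>\<^bsub>P\<^esub>) \<in> linear_maps K F P" by (simp add: linear_maps_def)
  let ?N = "{x \<in> carrier F. ?l x = \<zero>\<^bsub>P\<^esub>}"
  have sub: "submodule ?N K F"
    by (rule equalizer_submodule[OF F.module_axioms assms(1) l zero])
  have minus: "?l (x \<ominus>\<^bsub>F\<^esub> y) = \<zero>\<^bsub>P\<^esub>" if "x \<in> carrier F" "y \<in> carrier F" "?l x = ?l y" for x y
  proof -
    have "?l (x \<ominus>\<^bsub>F\<^esub> y) \<oplus>\<^bsub>P\<^esub> ?l y = ?l (x \<ominus>\<^bsub>F\<^esub> y \<oplus>\<^bsub>F\<^esub> y)"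
      using that by (simp add: linear_maps_add[OF l])
    also have "\<dots> = ?l y" using that by (simp add: F.minus_eq F.a_assoc F.l_neg)
    finally show ?thesis using that linear_maps_closed[OF l]
      by (intro P.add.l_cancel_one[THEN iffD1]) auto
  qed
  have "bilinear_relations K M N \<subseteq> ?N"
  proof -
    have N: "x \<ominus>\<^bsub>F\<^esub> y \<in> ?N" if "x \<in> carrier F" "y \<in> carrier F" "?l x = ?l y" for x y
      using minus that by simp
    note D = bilinear_mapD[OF assms(2)]
    note simps = gen_closed linear_maps_add[OF l] linear_maps_smult[OF l] gen
    show ?thesis unfolding bilinear_relations_def Let_def
      by (intro Un_least subsetI; elim CollectE exE conjE, hypsubst, rule N) (simp_all add: simps D)
  qed
  with sub have Z: "Z \<subseteq> ?N" unfolding tensor_null_def submodule_span_def by blast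
  have "(SOME g. g \<in> Z +>\<^bsub>F\<^esub> f) \<in> Z +>\<^bsub>F\<^esub> f"
    using T.Q.a_rcos_self[OF assms(3)] by (rule someI[of "\<lambda>g. g \<in> Z +>\<^bsub>F\<^esub> f"])
  then obtain z where z: "z \<in> Z" "(SOME g. g \<in> Z +>\<^bsub>F\<^esub> f) = z \<oplus>\<^bsub>F\<^esub> f"
    by (auto simp: a_r_coset_def')
  have "tensor_lift K P b (Z +>\<^bsub>F\<^esub> f) = ?l (z \<oplus>\<^bsub>F\<^esub> f)"
    unfolding tensor_lift_def z(2) lin_ext_def Let_def ..
  also have "\<dots> = ?l f"
    using z(1) Z assms(3) linear_maps_closed[OF l] by (auto simp: linear_maps_add[OF l] subset_eq)
  finally show ?thesis .
qed

lemma tensor_lift_linear: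
  assumes "module K P" "bilinear_map K M N P b"
  shows "tensor_lift K P b \<in> linear_maps K (M \<boxtimes>\<^bsub>K\<^esub> N) P"
proof -
  have b: "(\<lambda>p. b (fst p) (snd p)) \<in> carrier M \<times> carrier N \<rightarrow> carrier P"
    using bilinear_mapD(1)[OF assms(2)] by auto
  note l = lin_ext_linear[OF assms(1) b]
  show ?thesis unfolding linear_maps_def
    by (auto simp: tensor_product_def T.quotient_carrier T.quotient_add T.quotient_smult
        tensor_lift_coset[OF assms] linear_maps_closed[OF l] linear_maps_add[OF l]
        linear_maps_smult[OF l])
qed

lemma tensor_lift_pure:
  assumes "module K P" "bilinear_map K M N P b" "m \<in> carrier M" "n \<in> carrier N"
  shows "tensor_lift K P b (pure_tensor K M N m n) = b m n"
proof -
  have b: "(\<lambda>p. b (fst p) (snd p)) \<in> carrier M \<times> carrier N \<rightarrow> carrier P"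
    using bilinear_mapD(1)[OF assms(2)] by auto
  show ?thesis using lin_ext_gen[OF assms(1) b, of "(m, n)"] assms
    by (simp add: pure_tensor_def tensor_lift_coset gen_closed)
qed

lemma tensor_product_ext:
  assumes "module K P" "f \<in> linear_maps K (M \<boxtimes>\<^bsub>K\<^esub> N) P" "g \<in> linear_maps K (M \<boxtimes>\<^bsub>K\<^esub> N) P"
    and "\<And>m n. m \<in> carrier M \<Longrightarrow> n \<in> carrier N \<Longrightarrow>
      f (pure_tensor K M N m n) = g (pure_tensor K M N m n)"
    and "t \<in> carrier (M \<boxtimes>\<^bsub>K\<^esub> N)"
  shows "f t = g t"
proof -
  have lin: "(\<lambda>x. h (Z +>\<^bsub>F\<^esub> x)) \<in> linear_maps K F P" if "h \<in> linear_maps K (M \<boxtimes>\<^bsub>K\<^esub> N) P" for h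
    using proj_linear that unfolding linear_maps_def by (auto simp: Pi_def)
  obtain x where x: "x \<in> carrier F" "t = Z +>\<^bsub>F\<^esub> x"
    using assms(5) by (auto simp: tensor_product_def T.quotient_carrier)
  have "x \<in> {x \<in> carrier F. f (Z +>\<^bsub>F\<^esub> x) = g (Z +>\<^bsub>F\<^esub> x)}"
    by (rule free_module_induct[OF module.axioms(1)[OF M.module_axioms]
          equalizer_submodule[OF F.module_axioms assms(1) lin[OF assms(2)] lin[OF assms(3)]] _ x(1)])
       (use assms(4) gen_closed in \<open>auto simp: pure_tensor_def\<close>)
  thus ?thesis using x by simp
qed

end

lemma bilinear_mapI:
  assumes "\<And>m. m \<in> carrier M \<Longrightarrow> b m \<in> linear_maps K N P"
    and "\<And>n. n \<in> carrier N \<Longrightarrow> (\<lambda>m. b m n) \<in> linear_maps K M P"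
  shows "bilinear_map K M N P b"
  using assms by (simp add: bilinear_map_def)

lemma linear_maps_comp:
  "f \<in> linear_maps K M N \<Longrightarrow> g \<in> linear_maps K N P \<Longrightarrow> (\<lambda>x. g (f x)) \<in> linear_maps K M P"
  by (auto simp: linear_maps_def Pi_def)

lemma linear_maps_id: "id \<in> linear_maps K M M"
  by (auto simp: linear_maps_def)

lemma linear_maps_plus:
  assumes "module K M" "module K N" "f \<in> linear_maps K M N" "g \<in> linear_maps K M N"
  shows "(\<lambda>x. f x \<oplus>\<^bsub>N\<^esub> g x) \<in> linear_maps K M N"
proof -
  interpret N: module K N by fact
  note f = linear_maps_closed[OF assms(3)] and g = linear_maps_closed[OF assms(4)]
  show ?thesis unfolding linear_maps_def
    by (simp add: Pi_def f g linear_maps_add[OF assms(3)] linear_maps_add[OF assms(4)]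
        linear_maps_smult[OF assms(3)] linear_maps_smult[OF assms(4)] N.smult_r_distr N.a_ac)
qed

lemma linear_maps_scale:
  assumes "module K M" "module K N" "f \<in> linear_maps K M N" "c \<in> carrier K"
  shows "(\<lambda>x. c \<odot>\<^bsub>N\<^esub> f x) \<in> linear_maps K M N"
proof -
  interpret N: module K N by fact
  note f = linear_maps_closed[OF assms(3)]
  have "c \<odot>\<^bsub>N\<^esub> (d \<odot>\<^bsub>N\<^esub> f x) = d \<odot>\<^bsub>N\<^esub> (c \<odot>\<^bsub>N\<^esub> f x)" if "d \<in> carrier K" "x \<in> carrier M" for d x
    using that assms(4) f by (simp flip: N.smult_assoc1 add: N.R.m_comm)
  then show ?thesis unfolding linear_maps_def
    by (simp add: Pi_def f linear_maps_add[OF assms(3)] linear_maps_smult[OF assms(3)]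
        N.smult_r_distr assms(4))
qed

lemma bilinear_tensor_lift:
  assumes "module K L" "module K M" "module K N" "module K P"
    and b: "\<And>n. n \<in> carrier N \<Longrightarrow> bilinear_map K L M P (b n)"
    and lin: "\<And>l m. l \<in> carrier L \<Longrightarrow> m \<in> carrier M \<Longrightarrow> (\<lambda>n. b n l m) \<in> linear_maps K N P"
  shows "bilinear_map K N (L \<boxtimes>\<^bsub>K\<^esub> M) P (\<lambda>n. tensor_lift K P (b n))"
    and "bilinear_map K (L \<boxtimes>\<^bsub>K\<^esub> M) N P (\<lambda>t n. tensor_lift K P (b n) t)"
proof -
  interpret LM: two_modules K L M using assms by (simp add: two_modules_def)
  interpret N: module K N by fact
  interpret P: module K P by fact
  note T = LM.tensor_product_module
  have l: "tensor_lift K P (b n) \<in> linear_maps K (L \<boxtimes>\<^bsub>K\<^esub> M) P" if "n \<in> carrier N" for n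
    using LM.tensor_lift_linear[OF assms(4) b[OF that]] .
  have pure: "tensor_lift K P (b n) (pure_tensor K L M x y) = b n x y"
    if "n \<in> carrier N" "x \<in> carrier L" "y \<in> carrier M" for n x y
    using LM.tensor_lift_pure[OF assms(4) b[OF that(1)] that(2,3)] .
  have r: "(\<lambda>n. tensor_lift K P (b n) t) \<in> linear_maps K N P" if t: "t \<in> carrier (L \<boxtimes>\<^bsub>K\<^esub> M)" for t
    unfolding linear_maps_def
  proof (intro CollectI conjI ballI Pi_I)
    fix n assume n: "n \<in> carrier N"
    show "tensor_lift K P (b n) t \<in> carrier P" using linear_maps_closed[OF l[OF n] t] .
    fix n' assume n': "n' \<in> carrier N"
    have nn: "n \<oplus>\<^bsub>N\<^esub> n' \<in> carrier N" using n n' by simp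
    show "tensor_lift K P (b (n \<oplus>\<^bsub>N\<^esub> n')) t = tensor_lift K P (b n) t \<oplus>\<^bsub>P\<^esub> tensor_lift K P (b n') t"
      by (rule LM.tensor_product_ext[OF assms(4) l[OF nn] linear_maps_plus[OF T assms(4) l[OF n] l[OF n']] _ t])
         (simp only: pure nn n n' linear_maps_add[OF lin])
  next
    fix c n assume c: "c \<in> carrier K" and n: "n \<in> carrier N"
    have cn: "c \<odot>\<^bsub>N\<^esub> n \<in> carrier N" using c n by simp
    show "tensor_lift K P (b (c \<odot>\<^bsub>N\<^esub> n)) t = c \<odot>\<^bsub>P\<^esub> tensor_lift K P (b n) t"
      by (rule LM.tensor_product_ext[OF assms(4) l[OF cn] linear_maps_scale[OF T assms(4) l[OF n] c] _ t])
         (simp only: pure cn c n linear_maps_smult[OF lin])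
  qed
  show "bilinear_map K N (L \<boxtimes>\<^bsub>K\<^esub> M) P (\<lambda>n. tensor_lift K P (b n))"
    using l r by (rule bilinear_mapI)
  show "bilinear_map K (L \<boxtimes>\<^bsub>K\<^esub> M) N P (\<lambda>t n. tensor_lift K P (b n) t)"
    using r l by (rule bilinear_mapI)
qed

lemma
  assumes "module K M" "module K N" "module K P" "module K Q"
    and f: "f \<in> linear_maps K M P" and g: "g \<in> linear_maps K N Q"
  shows tensor_map_linear: "tensor_map K P Q f g \<in> linear_maps K (M \<boxtimes>\<^bsub>K\<^esub> N) (P \<boxtimes>\<^bsub>K\<^esub> Q)"
    and tensor_map_pure: "m \<in> carrier M \<Longrightarrow> n \<in> carrier N \<Longrightarrow>
      tensor_map K P Q f g (pure_tensor K M N m n) = pure_tensor K P Q (f m) (g n)"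
proof -
  interpret MN: two_modules K M N using assms by (simp add: two_modules_def)
  interpret PQ: two_modules K P Q using assms by (simp add: two_modules_def)
  have b: "bilinear_map K M N (P \<boxtimes>\<^bsub>K\<^esub> Q) (\<lambda>m n. pure_tensor K P Q (f m) (g n))"
  proof (rule bilinear_mapI)
    fix m assume "m \<in> carrier M"
    hence "pure_tensor K P Q (f m) \<in> linear_maps K Q (P \<boxtimes>\<^bsub>K\<^esub> Q)"
      using PQ.pure_tensor_bilinear linear_maps_closed[OF f] by (simp add: bilinear_map_def)
    from linear_maps_comp[OF g this]
    show "(\<lambda>n. pure_tensor K P Q (f m) (g n)) \<in> linear_maps K N (P \<boxtimes>\<^bsub>K\<^esub> Q)" .
  next
    fix n assume "n \<in> carrier N"
    hence "(\<lambda>p. pure_tensor K P Q p (g n)) \<in> linear_maps K P (P \<boxtimes>\<^bsub>K\<^esub> Q)"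
      using PQ.pure_tensor_bilinear linear_maps_closed[OF g] by (simp add: bilinear_map_def)
    from linear_maps_comp[OF f this]
    show "(\<lambda>m. pure_tensor K P Q (f m) (g n)) \<in> linear_maps K M (P \<boxtimes>\<^bsub>K\<^esub> Q)" .
  qed
  show "tensor_map K P Q f g \<in> linear_maps K (M \<boxtimes>\<^bsub>K\<^esub> N) (P \<boxtimes>\<^bsub>K\<^esub> Q)"
    unfolding tensor_map_def by (rule MN.tensor_lift_linear[OF PQ.tensor_product_module b])
  show "m \<in> carrier M \<Longrightarrow> n \<in> carrier N \<Longrightarrow>
      tensor_map K P Q f g (pure_tensor K M N m n) = pure_tensor K P Q (f m) (g n)"
    unfolding tensor_map_def by (rule MN.tensor_lift_pure[OF PQ.tensor_product_module b])
qed

lemma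
  assumes "module K L" "module K M" "module K N"
  shows tensor_assoc_linear:
      "tensor_assoc K L M N \<in> linear_maps K ((L \<boxtimes>\<^bsub>K\<^esub> M) \<boxtimes>\<^bsub>K\<^esub> N) (L \<boxtimes>\<^bsub>K\<^esub> (M \<boxtimes>\<^bsub>K\<^esub> N))"
    and tensor_assoc_pure:
      "l \<in> carrier L \<Longrightarrow> m \<in> carrier M \<Longrightarrow> n \<in> carrier N \<Longrightarrow>
       tensor_assoc K L M N (pure_tensor K (L \<boxtimes>\<^bsub>K\<^esub> M) N (pure_tensor K L M l m) n) =
       pure_tensor K L (M \<boxtimes>\<^bsub>K\<^esub> N) l (pure_tensor K M N m n)"
proof -
  interpret LM: two_modules K L M using assms by (simp add: two_modules_def)
  interpret MN: two_modules K M N using assms by (simp add: two_modules_def)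
  interpret L_MN: two_modules K L "M \<boxtimes>\<^bsub>K\<^esub> N"
    using assms MN.tensor_product_module by (simp add: two_modules_def)
  interpret LM_N: two_modules K "L \<boxtimes>\<^bsub>K\<^esub> M" N
    using assms LM.tensor_product_module by (simp add: two_modules_def)
  let ?P = "L \<boxtimes>\<^bsub>K\<^esub> (M \<boxtimes>\<^bsub>K\<^esub> N)"
  let ?b = "\<lambda>n l m. pure_tensor K L (M \<boxtimes>\<^bsub>K\<^esub> N) l (pure_tensor K M N m n)"
  have P: "module K ?P" by (rule L_MN.tensor_product_module)
  note o = L_MN.pure_tensor_bilinear[unfolded bilinear_map_def, THEN conjunct1, rule_format]
    and o' = L_MN.pure_tensor_bilinear[unfolded bilinear_map_def, THEN conjunct2, rule_format]
    and i = MN.pure_tensor_bilinear[unfolded bilinear_map_def, THEN conjunct1, rule_format]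
    and i' = MN.pure_tensor_bilinear[unfolded bilinear_map_def, THEN conjunct2, rule_format]
  have b: "bilinear_map K L M ?P (?b n)" if "n \<in> carrier N" for n
    using linear_maps_comp[OF i'[OF that] o] o' that MN.pure_tensor_closed by (intro bilinear_mapI) auto
  have lin: "(\<lambda>n. ?b n l m) \<in> linear_maps K N ?P" if "l \<in> carrier L" "m \<in> carrier M" for l m
    using linear_maps_comp[OF i o] that by auto
  note B = bilinear_tensor_lift(2)[OF assms P b lin]
  show "tensor_assoc K L M N \<in> linear_maps K ((L \<boxtimes>\<^bsub>K\<^esub> M) \<boxtimes>\<^bsub>K\<^esub> N) ?P"
    unfolding tensor_assoc_def by (rule LM_N.tensor_lift_linear[OF P B])
  show "tensor_assoc K L M N (pure_tensor K (L \<boxtimes>\<^bsub>K\<^esub> M) N (pure_tensor K L M l m) n) = ?b n l m"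
    if "l \<in> carrier L" "m \<in> carrier M" "n \<in> carrier N"
    unfolding tensor_assoc_def using that
    by (simp add: LM_N.tensor_lift_pure[OF P B] LM.pure_tensor_closed LM.tensor_lift_pure[OF P b])
qed

lemma
  assumes "module K L" "module K M" "module K N"
  shows tensor_unassoc_linear:
      "tensor_unassoc K L M N \<in> linear_maps K (L \<boxtimes>\<^bsub>K\<^esub> (M \<boxtimes>\<^bsub>K\<^esub> N)) ((L \<boxtimes>\<^bsub>K\<^esub> M) \<boxtimes>\<^bsub>K\<^esub> N)"
    and tensor_unassoc_pure:
      "l \<in> carrier L \<Longrightarrow> m \<in> carrier M \<Longrightarrow> n \<in> carrier N \<Longrightarrow>
       tensor_unassoc K L M N (pure_tensor K L (M \<boxtimes>\<^bsub>K\<^esub> N) l (pure_tensor K M N m n)) =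
       pure_tensor K (L \<boxtimes>\<^bsub>K\<^esub> M) N (pure_tensor K L M l m) n"
proof -
  interpret LM: two_modules K L M using assms by (simp add: two_modules_def)
  interpret MN: two_modules K M N using assms by (simp add: two_modules_def)
  interpret L_MN: two_modules K L "M \<boxtimes>\<^bsub>K\<^esub> N"
    using assms MN.tensor_product_module by (simp add: two_modules_def)
  interpret LM_N: two_modules K "L \<boxtimes>\<^bsub>K\<^esub> M" N
    using assms LM.tensor_product_module by (simp add: two_modules_def)
  let ?P = "(L \<boxtimes>\<^bsub>K\<^esub> M) \<boxtimes>\<^bsub>K\<^esub> N"
  let ?b = "\<lambda>l m n. pure_tensor K (L \<boxtimes>\<^bsub>K\<^esub> M) N (pure_tensor K L M l m) n"
  have P: "module K ?P" by (rule LM_N.tensor_product_module)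
  note o = LM_N.pure_tensor_bilinear[unfolded bilinear_map_def, THEN conjunct1, rule_format]
    and o' = LM_N.pure_tensor_bilinear[unfolded bilinear_map_def, THEN conjunct2, rule_format]
    and i = LM.pure_tensor_bilinear[unfolded bilinear_map_def, THEN conjunct1, rule_format]
    and i' = LM.pure_tensor_bilinear[unfolded bilinear_map_def, THEN conjunct2, rule_format]
  have b: "bilinear_map K M N ?P (?b l)" if "l \<in> carrier L" for l
    using linear_maps_comp[OF i[OF that] o'] o that LM.pure_tensor_closed by (intro bilinear_mapI) auto
  have lin: "(\<lambda>l. ?b l m n) \<in> linear_maps K L ?P" if "m \<in> carrier M" "n \<in> carrier N" for m n
    using linear_maps_comp[OF i' o'] that by auto
  note B = bilinear_tensor_lift(1)[OF assms(2,3,1) P b lin]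
  show "tensor_unassoc K L M N \<in> linear_maps K (L \<boxtimes>\<^bsub>K\<^esub> (M \<boxtimes>\<^bsub>K\<^esub> N)) ?P"
    unfolding tensor_unassoc_def by (rule L_MN.tensor_lift_linear[OF P B])
  show "tensor_unassoc K L M N (pure_tensor K L (M \<boxtimes>\<^bsub>K\<^esub> N) l (pure_tensor K M N m n)) = ?b l m n"
    if "l \<in> carrier L" "m \<in> carrier M" "n \<in> carrier N"
    unfolding tensor_unassoc_def using that
    by (simp add: L_MN.tensor_lift_pure[OF P B] MN.pure_tensor_closed MN.tensor_lift_pure[OF P b])
qed


section \<open>Crossed products\<close>

text \<open>
  Iterated tensor products are bracketed to the right, so \<open>A \<otimes> A \<otimes> V\<close> is \<open>A \<otimes> (A \<otimes> V)\<close>; the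
  associators that are usually suppressed are inserted. For \<open>f : M \<otimes> N \<rightarrow> P \<otimes> Q\<close>,
  \<open>tensor_first K M N P Q U f\<close> is \<open>f \<otimes> id : M \<otimes> (N \<otimes> U) \<rightarrow> P \<otimes> (Q \<otimes> U)\<close>.
\<close>

definition tensor_first ::
  "'k ring \<Rightarrow> ('k, 'm) module \<Rightarrow> ('k, 'n) module \<Rightarrow> ('k, 'p) module \<Rightarrow> ('k, 'q) module
    \<Rightarrow> ('k, 'x) module \<Rightarrow> (('m \<times> 'n \<Rightarrow> 'k) set \<Rightarrow> ('p \<times> 'q \<Rightarrow> 'k) set)
    \<Rightarrow> ('m \<times> ('n \<times> 'x \<Rightarrow> 'k) set \<Rightarrow> 'k) set \<Rightarrow> ('p \<times> ('q \<times> 'x \<Rightarrow> 'k) set \<Rightarrow> 'k) set" where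
  "tensor_first K M N P Q U f =
     tensor_assoc K P Q U \<circ> tensor_map K (P \<boxtimes>\<^bsub>K\<^esub> Q) U f id \<circ> tensor_unassoc K M N U"

text \<open>\<open>\<mu> : A \<otimes> A \<rightarrow> A\<close> and \<open>\<mu>\<^sub>2 : A \<otimes> A \<otimes> A \<rightarrow> A\<close>\<close>

definition mult_map :: "'k ring \<Rightarrow> ('k, 'a) module \<Rightarrow> ('a \<times> 'a \<Rightarrow> 'k) set \<Rightarrow> 'a" where
  "mult_map K A = tensor_lift K A (\<lambda>a b. a \<otimes>\<^bsub>A\<^esub> b)"

definition mult2_map ::
  "'k ring \<Rightarrow> ('k, 'a) module \<Rightarrow> ('a \<times> ('a \<times> 'a \<Rightarrow> 'k) set \<Rightarrow> 'k) set \<Rightarrow> 'a" where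
  "mult2_map K A = mult_map K A \<circ> tensor_map K A A id (mult_map K A)"

text \<open>\<open>\<mu> \<otimes> id : A \<otimes> A \<otimes> U \<rightarrow> A \<otimes> U\<close> and \<open>\<mu>\<^sub>2 \<otimes> id : A \<otimes> A \<otimes> A \<otimes> U \<rightarrow> A \<otimes> U\<close>\<close>

definition mult_first ::
  "'k ring \<Rightarrow> ('k, 'a) module \<Rightarrow> ('k, 'x) module
    \<Rightarrow> ('a \<times> ('a \<times> 'x \<Rightarrow> 'k) set \<Rightarrow> 'k) set \<Rightarrow> ('a \<times> 'x \<Rightarrow> 'k) set" where
  "mult_first K A U = tensor_map K A U (mult_map K A) id \<circ> tensor_unassoc K A A U"

definition mult2_first ::
  "'k ring \<Rightarrow> ('k, 'a) module \<Rightarrow> ('k, 'x) module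
    \<Rightarrow> ('a \<times> ('a \<times> ('a \<times> 'x \<Rightarrow> 'k) set \<Rightarrow> 'k) set \<Rightarrow> 'k) set \<Rightarrow> ('a \<times> 'x \<Rightarrow> 'k) set" where
  "mult2_first K A U =
     tensor_map K A U (mult2_map K A) id \<circ>
     tensor_unassoc K A (A \<boxtimes>\<^bsub>K\<^esub> A) U \<circ>
     tensor_map K A ((A \<boxtimes>\<^bsub>K\<^esub> A) \<boxtimes>\<^bsub>K\<^esub> U) id (tensor_unassoc K A A U)"

locale crossed_product_data =
  K: field K + A: assoc_algebra K A + V: module K V
  for K :: "'k ring" and A :: "('k, 'a) module" and V :: "('k, 'v) module" +
  fixes unitV :: 'v
    and R :: "('v \<times> 'a \<Rightarrow> 'k) set \<Rightarrow> ('a \<times> 'v \<Rightarrow> 'k) set"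
    and \<sigma> :: "('v \<times> 'v \<Rightarrow> 'k) set \<Rightarrow> ('a \<times> 'v \<Rightarrow> 'k) set"
  assumes unitV_closed: "unitV \<in> carrier V"
    and R_linear: "R \<in> linear_maps K (V \<boxtimes>\<^bsub>K\<^esub> A) (A \<boxtimes>\<^bsub>K\<^esub> V)"
    and \<sigma>_linear: "\<sigma> \<in> linear_maps K (V \<boxtimes>\<^bsub>K\<^esub> V) (A \<boxtimes>\<^bsub>K\<^esub> V)"
    and R_unitV: "\<And>a. a \<in> carrier A \<Longrightarrow>
      R (pure_tensor K V A unitV a) = pure_tensor K A V a unitV"
    and R_unitA: "\<And>v. v \<in> carrier V \<Longrightarrow>
      R (pure_tensor K V A v \<one>\<^bsub>A\<^esub>) = pure_tensor K A V \<one>\<^bsub>A\<^esub> v"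
    and \<sigma>_unit_left: "\<And>v. v \<in> carrier V \<Longrightarrow>
      \<sigma> (pure_tensor K V V unitV v) = pure_tensor K A V \<one>\<^bsub>A\<^esub> v"
    and \<sigma>_unit_right: "\<And>v. v \<in> carrier V \<Longrightarrow>
      \<sigma> (pure_tensor K V V v unitV) = pure_tensor K A V \<one>\<^bsub>A\<^esub> v"
    and R_mult: "\<And>t. t \<in> carrier (V \<boxtimes>\<^bsub>K\<^esub> (A \<boxtimes>\<^bsub>K\<^esub> A)) \<Longrightarrow>
      (R \<circ> tensor_map K V A id (mult_map K A)) t =
      (mult_first K A V \<circ> tensor_map K A (A \<boxtimes>\<^bsub>K\<^esub> V) id R \<circ> tensor_first K V A A V A R) t"
    and cocycle: "\<And>t. t \<in> carrier (V \<boxtimes>\<^bsub>K\<^esub> (V \<boxtimes>\<^bsub>K\<^esub> V)) \<Longrightarrow>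
      (mult_first K A V \<circ> tensor_map K A (A \<boxtimes>\<^bsub>K\<^esub> V) id \<sigma> \<circ> tensor_first K V A A V V R \<circ>
        tensor_map K V (A \<boxtimes>\<^bsub>K\<^esub> V) id \<sigma>) t =
      (mult_first K A V \<circ> tensor_map K A (A \<boxtimes>\<^bsub>K\<^esub> V) id \<sigma> \<circ> tensor_first K V V A V V \<sigma>) t"
    and twisted_module: "\<And>t. t \<in> carrier (V \<boxtimes>\<^bsub>K\<^esub> (V \<boxtimes>\<^bsub>K\<^esub> A)) \<Longrightarrow>
      (mult_first K A V \<circ> tensor_map K A (A \<boxtimes>\<^bsub>K\<^esub> V) id \<sigma> \<circ> tensor_first K V A A V V R \<circ>
        tensor_map K V (A \<boxtimes>\<^bsub>K\<^esub> V) id R) t =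
      (mult_first K A V \<circ> tensor_map K A (A \<boxtimes>\<^bsub>K\<^esub> V) id R \<circ> tensor_first K V V A V A \<sigma>) t"

definition crossed_mult ::
  "'k ring \<Rightarrow> ('k, 'a) module \<Rightarrow> ('k, 'v) module
    \<Rightarrow> (('v \<times> 'a \<Rightarrow> 'k) set \<Rightarrow> ('a \<times> 'v \<Rightarrow> 'k) set)
    \<Rightarrow> (('v \<times> 'v \<Rightarrow> 'k) set \<Rightarrow> ('a \<times> 'v \<Rightarrow> 'k) set)
    \<Rightarrow> (('a \<times> 'v \<Rightarrow> 'k) set \<times> ('a \<times> 'v \<Rightarrow> 'k) set \<Rightarrow> 'k) set \<Rightarrow> ('a \<times> 'v \<Rightarrow> 'k) set" where
  "crossed_mult K A V R \<sigma> =
     mult2_first K A V \<circ>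
     tensor_map K A (A \<boxtimes>\<^bsub>K\<^esub> (A \<boxtimes>\<^bsub>K\<^esub> V)) id (tensor_map K A (A \<boxtimes>\<^bsub>K\<^esub> V) id \<sigma>) \<circ>
     tensor_map K A (A \<boxtimes>\<^bsub>K\<^esub> (V \<boxtimes>\<^bsub>K\<^esub> V)) id (tensor_first K V A A V V R) \<circ>
     tensor_assoc K A V (A \<boxtimes>\<^bsub>K\<^esub> V)"

definition crossed_product ::
  "'k ring \<Rightarrow> ('k, 'a) module \<Rightarrow> ('k, 'v) module \<Rightarrow> 'v
    \<Rightarrow> (('v \<times> 'a \<Rightarrow> 'k) set \<Rightarrow> ('a \<times> 'v \<Rightarrow> 'k) set)
    \<Rightarrow> (('v \<times> 'v \<Rightarrow> 'k) set \<Rightarrow> ('a \<times> 'v \<Rightarrow> 'k) set)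
    \<Rightarrow> ('k, ('a \<times> 'v \<Rightarrow> 'k) set) module" where
  "crossed_product K A V unitV R \<sigma> = (A \<boxtimes>\<^bsub>K\<^esub> V)\<lparr>
     mult := (\<lambda>x y. crossed_mult K A V R \<sigma> (pure_tensor K (A \<boxtimes>\<^bsub>K\<^esub> V) (A \<boxtimes>\<^bsub>K\<^esub> V) x y)),
     one := pure_tensor K A V \<one>\<^bsub>A\<^esub> unitV\<rparr>"

definition algebra_isos ::
  "'k ring \<Rightarrow> ('k, 'a) module \<Rightarrow> ('k, 'b) module \<Rightarrow> ('a \<Rightarrow> 'b) set" where
  "algebra_isos K A B = ring_iso A B \<inter> linear_maps K A B"

definition equivalent_crossed_products ::
  "'k ring \<Rightarrow> ('k, 'a) module \<Rightarrow> ('k, 'v) module \<Rightarrow> 'v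
    \<Rightarrow> (('v \<times> 'a \<Rightarrow> 'k) set \<Rightarrow> ('a \<times> 'v \<Rightarrow> 'k) set)
    \<Rightarrow> (('v \<times> 'v \<Rightarrow> 'k) set \<Rightarrow> ('a \<times> 'v \<Rightarrow> 'k) set)
    \<Rightarrow> (('v \<times> 'a \<Rightarrow> 'k) set \<Rightarrow> ('a \<times> 'v \<Rightarrow> 'k) set)
    \<Rightarrow> (('v \<times> 'v \<Rightarrow> 'k) set \<Rightarrow> ('a \<times> 'v \<Rightarrow> 'k) set) \<Rightarrow> bool" where
  "equivalent_crossed_products K A V unitV R \<sigma> R' \<sigma>' \<longleftrightarrow>
     (\<exists>\<phi> \<in> algebra_isos K (crossed_product K A V unitV R' \<sigma>') (crossed_product K A V unitV R \<sigma>).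
        \<forall>a\<in>carrier A. \<phi> (pure_tensor K A V a unitV) = pure_tensor K A V a unitV)"

end

theory Submission
  imports Defs
begin

text \<open>
  A crossed product contains \<open>A\<close> as \<open>A \<otimes> 1\<^sub>V\<close>, and left multiplication by \<open>a \<otimes> 1\<^sub>V\<close> is the obvious left
  action of \<open>a\<close> on \<open>A \<otimes> V\<close>, whatever \<open>R\<close> and \<open>\<sigma>\<close> are (\<open>unitV_cmult\<close>). An algebra isomorphism \<open>\<phi>\<close> that
  fixes \<open>A \<otimes> 1\<^sub>V\<close> is therefore left \<open>A\<close>-linear. Since \<open>A \<otimes> V\<close> is a free left \<open>A\<close>-module on \<open>V\<close>, the maps
  \<open>\<phi>\<close> and \<open>\<phi>\<inverse>\<close> amount to linear maps \<open>\<theta>, \<gamma> : V \<rightarrow> A \<otimes> V\<close>, namely their restrictions to \<open>1 \<otimes> V\<close>. In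
  the other direction \<open>\<theta>\<close> extends to the left \<open>A\<close>-linear map \<open>lext \<theta> = (\<mu> \<otimes> id) \<circ> (id \<otimes> \<theta>)\<close>.

  Write \<open>\<star>\<close> for the multiplication of \<open>A \<otimes>\<^bsub>R,\<sigma>\<^esub> V\<close> and \<open>\<star>'\<close> for that of \<open>A \<otimes>\<^bsub>R',\<sigma>'\<^esub> V\<close>. The structure
  maps are values of the multiplication, \<open>R (v \<otimes> a) = (1 \<otimes> v) \<star> (a \<otimes> 1\<^sub>V)\<close> and
  \<open>\<sigma> (v \<otimes> w) = (1 \<otimes> v) \<star> (1 \<otimes> w)\<close> (\<open>R_eq_cmult\<close>, \<open>\<sigma>_eq_cmult\<close>), so the conditions on \<open>\<theta>\<close> and \<open>\<gamma>\<close> are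
  identities about products:
  \<^item> (i) says \<open>(1 \<otimes> v) \<star>' (a \<otimes> 1\<^sub>V) = lext \<gamma> (\<theta> v \<star> (a \<otimes> 1\<^sub>V))\<close>;
  \<^item> (ii) says \<open>(1 \<otimes> v) \<star>' (1 \<otimes> w) = lext \<gamma> (\<theta> v \<star> \<theta> w)\<close>;
  \<^item> (iv) and (v) say that \<open>lext \<theta>\<close> and \<open>lext \<gamma>\<close> are inverse to each other;
  \<^item> (vi) says \<open>\<gamma> v \<star>' \<gamma> w = lext \<gamma> ((1 \<otimes> v) \<star> (1 \<otimes> w))\<close>, as soon as \<open>lext \<gamma>\<close> respects right
    multiplication by \<open>A \<otimes> 1\<^sub>V\<close> (\<open>mixed_product_pure\<close>).

  All of them are clear when \<open>\<theta>\<close> and \<open>\<gamma>\<close> come from an isomorphism (\<open>maps_of_isomorphism\<close>). Conversely, (i)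
  and (v) imply that \<open>lext \<gamma>\<close> respects right multiplication by \<open>A \<otimes> 1\<^sub>V\<close>, and then (vi) implies that it
  respects right multiplication by \<open>1 \<otimes> V\<close>. As every \<open>a \<otimes> w\<close> is a product of elements of these two
  kinds, \<open>lext \<gamma>\<close> is multiplicative (\<open>lext_multiplicative\<close>), and \<open>lext \<theta>\<close>, being its inverse, is the
  required isomorphism.
\<close>

section \<open>Linear maps between tensor products\<close>

lemma two_modulesI: "module K M \<Longrightarrow> module K N \<Longrightarrow> two_modules K M N"
  by (simp add: two_modules_def)

lemma tensor_module: "module K M \<Longrightarrow> module K N \<Longrightarrow> module K (M \<boxtimes>\<^bsub>K\<^esub> N)"
  by (rule two_modules.tensor_product_module[OF two_modulesI])

lemma pure_tensor_closed:
  "module K M \<Longrightarrow> module K N \<Longrightarrow> m \<in> carrier M \<Longrightarrow> n \<in> carrier N \<Longrightarrow>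
   pure_tensor K M N m n \<in> carrier (M \<boxtimes>\<^bsub>K\<^esub> N)"
  by (rule two_modules.pure_tensor_closed[OF two_modulesI])

lemma linear_maps_o: "f \<in> linear_maps K M N \<Longrightarrow> g \<in> linear_maps K N P \<Longrightarrow> g \<circ> f \<in> linear_maps K M P"
  unfolding comp_def by (rule linear_maps_comp)

lemma linear_maps_cong:
  assumes "f \<in> linear_maps K M N" "module K M" "\<And>x. x \<in> carrier M \<Longrightarrow> g x = f x"
  shows "g \<in> linear_maps K M N"
proof -
  interpret M: module K M by fact
  show ?thesis using assms(1,3) by (simp add: linear_maps_def Pi_iff)
qed

lemma linear_maps_inv_into:
  assumes "module K M" and f: "f \<in> linear_maps K M N" and bij: "bij_betw f (carrier M) (carrier N)"
  shows "inv_into (carrier M) f \<in> linear_maps K N M"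
proof -
  interpret M: module K M by fact
  let ?g = "inv_into (carrier M) f"
  have g: "?g y \<in> carrier M" "f (?g y) = y" if "y \<in> carrier N" for y
    using bij that by (auto simp: bij_betw_def inv_into_into f_inv_into_f)
  have eqI: "?g y = x" if "x \<in> carrier M" "f x = y" for x y
    using bij_betw_inv_into_left[OF bij that(1)] that(2) by simp
  show ?thesis unfolding linear_maps_def
    by (auto simp: g linear_maps_add[OF f] linear_maps_smult[OF f] intro!: eqI)
qed

lemma pure_tensor_linear_left:
  "module K M \<Longrightarrow> module K N \<Longrightarrow> n \<in> carrier N \<Longrightarrow>
   (\<lambda>m. pure_tensor K M N m n) \<in> linear_maps K M (M \<boxtimes>\<^bsub>K\<^esub> N)"
  using two_modules.pure_tensor_bilinear[OF two_modulesI, of K M N] by (simp add: bilinear_map_def)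

lemma pure_tensor_linear_right:
  "module K M \<Longrightarrow> module K N \<Longrightarrow> m \<in> carrier M \<Longrightarrow>
   pure_tensor K M N m \<in> linear_maps K N (M \<boxtimes>\<^bsub>K\<^esub> N)"
  using two_modules.pure_tensor_bilinear[OF two_modulesI, of K M N] by (simp add: bilinear_map_def)

lemma tensor_first_linear:
  assumes "module K M" "module K N" "module K P" "module K Q" "module K U"
    and "f \<in> linear_maps K (M \<boxtimes>\<^bsub>K\<^esub> N) (P \<boxtimes>\<^bsub>K\<^esub> Q)"
  shows "tensor_first K M N P Q U f \<in> linear_maps K (M \<boxtimes>\<^bsub>K\<^esub> (N \<boxtimes>\<^bsub>K\<^esub> U)) (P \<boxtimes>\<^bsub>K\<^esub> (Q \<boxtimes>\<^bsub>K\<^esub> U))"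
  unfolding tensor_first_def
  by (intro linear_maps_o[OF tensor_unassoc_linear] linear_maps_o[OF _ tensor_assoc_linear]
      tensor_map_linear tensor_module linear_maps_id assms)

lemma tensor_first_pure:
  assumes "module K M" "module K N" "module K P" "module K Q" "module K U"
    and "f \<in> linear_maps K (M \<boxtimes>\<^bsub>K\<^esub> N) (P \<boxtimes>\<^bsub>K\<^esub> Q)"
    and "m \<in> carrier M" "n \<in> carrier N" "u \<in> carrier U"
  shows "tensor_first K M N P Q U f (pure_tensor K M (N \<boxtimes>\<^bsub>K\<^esub> U) m (pure_tensor K N U n u)) =
    tensor_assoc K P Q U (pure_tensor K (P \<boxtimes>\<^bsub>K\<^esub> Q) U (f (pure_tensor K M N m n)) u)"
  using assms unfolding tensor_first_def
  by (simp add: tensor_unassoc_pure tensor_map_pure[where M="M \<boxtimes>\<^bsub>K\<^esub> N" and P="P \<boxtimes>\<^bsub>K\<^esub> Q"]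
      tensor_module linear_maps_id pure_tensor_closed)


section \<open>The left \<open>A\<close>-module \<open>A \<otimes> V\<close>\<close>

definition left_extension ::
  "'k ring \<Rightarrow> ('k, 'a) module \<Rightarrow> ('k, 'v) module \<Rightarrow> ('u \<Rightarrow> ('a \<times> 'v \<Rightarrow> 'k) set)
    \<Rightarrow> ('a \<times> 'u \<Rightarrow> 'k) set \<Rightarrow> ('a \<times> 'v \<Rightarrow> 'k) set" where
  "left_extension K A V f t = mult_first K A V (tensor_map K A (A \<boxtimes>\<^bsub>K\<^esub> V) id f t)"

locale algebra_with_module = A: assoc_algebra K A + V: module K V
  for K :: "'k ring" and A :: "('k, 'a) module" and V :: "('k, 'v) module"
begin

abbreviation AV where "AV \<equiv> A \<boxtimes>\<^bsub>K\<^esub> V"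

abbreviation tensor_elem (infix "\<bullet>" 71) where
  "a \<bullet> v \<equiv> pure_tensor K A V a v"

abbreviation act (infixr "\<rhd>" 69) where
  "a \<rhd> x \<equiv> mult_first K A V (pure_tensor K A AV a x)"

abbreviation lext where "lext \<equiv> left_extension K A V"

lemma A_module: "module K A" by unfold_locales
lemma V_module: "module K V" by unfold_locales
lemmas AV_module = tensor_module[OF A_module V_module]
lemmas modules = A_module V_module tensor_module

lemma elem_closed: "a \<in> carrier A \<Longrightarrow> v \<in> carrier V \<Longrightarrow> a \<bullet> v \<in> carrier AV"
  by (simp add: pure_tensor_closed modules)

lemma mult_bilinear: "bilinear_map K A A A (\<lambda>a b. a \<otimes>\<^bsub>A\<^esub> b)"
  by (rule bilinear_mapI)
     (auto simp: linear_maps_def A.l_distr A.r_distr A.smult_mult_left A.smult_mult_right)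

lemma mult_map_linear: "mult_map K A \<in> linear_maps K (A \<boxtimes>\<^bsub>K\<^esub> A) A"
  unfolding mult_map_def
  by (rule two_modules.tensor_lift_linear[OF two_modulesI A_module mult_bilinear]) (rule A_module)+

lemma mult_map_pure:
  "a \<in> carrier A \<Longrightarrow> b \<in> carrier A \<Longrightarrow> mult_map K A (pure_tensor K A A a b) = a \<otimes>\<^bsub>A\<^esub> b"
  unfolding mult_map_def
  by (rule two_modules.tensor_lift_pure[OF two_modulesI A_module mult_bilinear]) (auto intro: A_module)

lemma mult_first_linear: "mult_first K A V \<in> linear_maps K (A \<boxtimes>\<^bsub>K\<^esub> AV) AV"
  unfolding mult_first_def
  by (intro linear_maps_o[OF tensor_unassoc_linear] tensor_map_linear modules linear_maps_id mult_map_linear)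

lemma act_linear_right: "a \<in> carrier A \<Longrightarrow> (\<lambda>x. a \<rhd> x) \<in> linear_maps K AV AV"
  by (intro linear_maps_comp[OF pure_tensor_linear_right mult_first_linear] modules)

lemma act_closed: "a \<in> carrier A \<Longrightarrow> x \<in> carrier AV \<Longrightarrow> a \<rhd> x \<in> carrier AV"
  by (rule linear_maps_closed[OF act_linear_right])

lemma act_elem:
  assumes "a \<in> carrier A" "b \<in> carrier A" "v \<in> carrier V"
  shows "a \<rhd> b \<bullet> v = (a \<otimes>\<^bsub>A\<^esub> b) \<bullet> v"
  using assms unfolding mult_first_def
  by (simp add: tensor_unassoc_pure modules tensor_map_pure[OF _ _ _ _ mult_map_linear linear_maps_id]
      pure_tensor_closed mult_map_pure)

lemma act_one_elem: "a \<in> carrier A \<Longrightarrow> v \<in> carrier V \<Longrightarrow> a \<rhd> \<one>\<^bsub>A\<^esub> \<bullet> v = a \<bullet> v"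
  by (simp add: act_elem)

lemma AV_ext:
  assumes "module K P" "f \<in> linear_maps K AV P" "g \<in> linear_maps K AV P"
    and "\<And>a v. a \<in> carrier A \<Longrightarrow> v \<in> carrier V \<Longrightarrow> f (a \<bullet> v) = g (a \<bullet> v)"
    and "x \<in> carrier AV"
  shows "f x = g x"
  using two_modules.tensor_product_ext[OF two_modulesI assms(1-3)] assms(4,5) modules by blast

lemma act_mult:
  assumes "a \<in> carrier A" "b \<in> carrier A" "x \<in> carrier AV"
  shows "(a \<otimes>\<^bsub>A\<^esub> b) \<rhd> x = a \<rhd> b \<rhd> x"
  by (rule AV_ext[OF AV_module act_linear_right
        linear_maps_comp[OF act_linear_right act_linear_right] _ assms(3)])
     (use assms in \<open>simp_all add: act_elem A.m_assoc\<close>)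

lemma act_one:
  assumes "x \<in> carrier AV" shows "\<one>\<^bsub>A\<^esub> \<rhd> x = x"
  by (rule AV_ext[OF AV_module act_linear_right linear_maps_id[unfolded id_def] _ assms])
     (simp_all add: act_elem)

text \<open>
  Since \<open>A \<otimes> U\<close> is the free left \<open>A\<close>-module on \<open>U\<close>, linear maps \<open>f : U \<rightarrow> A \<otimes> V\<close> correspond to left
  \<open>A\<close>-linear maps \<open>A \<otimes> U \<rightarrow> A \<otimes> V\<close>; \<open>left_extension\<close> realises this correspondence. All composites of
  tensor maps that occur later are brought into the form of such extensions by the next lemmas.
\<close>

lemma lext_linear:
  assumes "module K U" "f \<in> linear_maps K U AV"
  shows "lext f \<in> linear_maps K (A \<boxtimes>\<^bsub>K\<^esub> U) AV"
  unfolding left_extension_def[abs_def]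
  by (intro linear_maps_comp[OF tensor_map_linear mult_first_linear] modules linear_maps_id assms)

lemma lext_closed:
  "module K U \<Longrightarrow> f \<in> linear_maps K U AV \<Longrightarrow> t \<in> carrier (A \<boxtimes>\<^bsub>K\<^esub> U) \<Longrightarrow> lext f t \<in> carrier AV"
  by (rule linear_maps_closed[OF lext_linear])

lemma lext_pure:
  assumes "module K U" "f \<in> linear_maps K U AV" "a \<in> carrier A" "u \<in> carrier U"
  shows "lext f (pure_tensor K A U a u) = a \<rhd> f u"
  using assms unfolding left_extension_def
  by (simp add: tensor_map_pure[OF _ _ _ _ linear_maps_id assms(2)] modules)

lemma lext_unique:
  assumes "module K U" "f \<in> linear_maps K U AV" "h \<in> linear_maps K (A \<boxtimes>\<^bsub>K\<^esub> U) AV"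
    and "\<And>a u. a \<in> carrier A \<Longrightarrow> u \<in> carrier U \<Longrightarrow> h (pure_tensor K A U a u) = a \<rhd> f u"
    and "t \<in> carrier (A \<boxtimes>\<^bsub>K\<^esub> U)"
  shows "h t = lext f t"
  by (rule two_modules.tensor_product_ext[OF two_modulesI AV_module assms(3) lext_linear])
     (use assms modules in \<open>simp_all add: lext_pure\<close>)

lemma lext_act:
  assumes "f \<in> linear_maps K V AV" "a \<in> carrier A" "x \<in> carrier AV"
  shows "lext f (a \<rhd> x) = a \<rhd> lext f x"
  by (rule AV_ext[OF AV_module linear_maps_comp[OF act_linear_right lext_linear]
        linear_maps_comp[OF lext_linear act_linear_right] _ assms(3)])
     (use assms in \<open>simp_all add: V_module act_elem lext_pure act_mult linear_maps_closed[of f]\<close>)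

lemma lext_tensor_map:
  assumes "module K U" "module K W" "f \<in> linear_maps K W AV" "h \<in> linear_maps K U W"
    and "t \<in> carrier (A \<boxtimes>\<^bsub>K\<^esub> U)"
  shows "lext f (tensor_map K A W id h t) = lext (\<lambda>u. f (h u)) t"
  by (rule lext_unique[OF assms(1) linear_maps_comp[OF assms(4,3)]
        linear_maps_comp[OF tensor_map_linear lext_linear] _ assms(5)])
     (use assms in \<open>simp_all add: modules linear_maps_id linear_maps_closed[of h]
        tensor_map_pure[OF _ _ _ _ linear_maps_id assms(4)] lext_pure\<close>)

lemma lext_lext:
  assumes "module K U" "f \<in> linear_maps K U AV" "g \<in> linear_maps K V AV"
    and "t \<in> carrier (A \<boxtimes>\<^bsub>K\<^esub> U)"
  shows "lext g (lext f t) = lext (\<lambda>u. lext g (f u)) t"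
  by (rule lext_unique[OF assms(1) linear_maps_comp[OF assms(2) lext_linear]
        linear_maps_comp[OF lext_linear lext_linear] _ assms(4)])
     (use assms in \<open>simp_all add: V_module lext_pure lext_act linear_maps_closed[of f]\<close>)

text \<open>
  Evaluating \<open>f : V \<otimes> U \<rightarrow> A \<otimes> V\<close> on \<open>x \<otimes> u\<close> with an arbitrary, not necessarily pure, \<open>x \<in> A \<otimes> V\<close> is
  left \<open>A\<close>-linear in \<open>x\<close>. This removes the associators: for \<open>f = R\<close> and \<open>f = \<sigma>\<close> the result is right
  multiplication by \<open>u \<otimes> 1\<^sub>V\<close> and by \<open>1 \<otimes> u\<close> in the crossed product.
\<close>

lemma lext_assoc:
  assumes "module K U" "f \<in> linear_maps K (V \<boxtimes>\<^bsub>K\<^esub> U) AV" "x \<in> carrier AV" "u \<in> carrier U"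
  shows "lext f (tensor_assoc K A V U (pure_tensor K AV U x u)) = lext (\<lambda>v. f (pure_tensor K V U v u)) x"
  by (rule lext_unique[OF V_module linear_maps_comp[OF pure_tensor_linear_left assms(2)]
        linear_maps_comp[OF pure_tensor_linear_left linear_maps_comp[OF tensor_assoc_linear lext_linear]]
        _ assms(3)])
     (use assms in \<open>simp_all add: modules tensor_assoc_pure lext_pure pure_tensor_closed\<close>)

lemma lext_cong:
  assumes "module K U" "f \<in> linear_maps K U AV" "t \<in> carrier (A \<boxtimes>\<^bsub>K\<^esub> U)"
    and "\<And>u. u \<in> carrier U \<Longrightarrow> g u = f u"
  shows "lext g t = lext f t"
  by (rule lext_unique[OF assms(1,2) lext_linear[OF _ linear_maps_cong] _ assms(3)])
     (use assms linear_maps_cong[OF assms(2,1,4)] in \<open>simp_all add: lext_pure\<close>)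

text \<open>A left \<open>A\<close>-linear endomorphism is determined by its values on \<open>1 \<otimes> V\<close>.\<close>

lemma left_linear_eq_lext:
  assumes "h \<in> linear_maps K AV AV"
    and "\<And>a x. a \<in> carrier A \<Longrightarrow> x \<in> carrier AV \<Longrightarrow> h (a \<rhd> x) = a \<rhd> h x"
    and "x \<in> carrier AV"
  shows "h x = lext (\<lambda>v. h (\<one>\<^bsub>A\<^esub> \<bullet> v)) x"
proof (rule lext_unique[OF V_module _ assms(1) _ assms(3)])
  show "(\<lambda>v. h (\<one>\<^bsub>A\<^esub> \<bullet> v)) \<in> linear_maps K V AV"
    by (intro linear_maps_comp[OF pure_tensor_linear_right assms(1)] modules A.one_closed)
  fix a v assume "a \<in> carrier A" "v \<in> carrier V"
  thus "h (a \<bullet> v) = a \<rhd> h (\<one>\<^bsub>A\<^esub> \<bullet> v)"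
    using assms(2)[of a "\<one>\<^bsub>A\<^esub> \<bullet> v"] by (simp add: act_one_elem elem_closed)
qed

lemma lext_unit:
  assumes "x \<in> carrier AV" shows "lext (\<lambda>v. \<one>\<^bsub>A\<^esub> \<bullet> v) x = x"
  using left_linear_eq_lext[OF linear_maps_id _ assms] by simp

lemma mult2_map_linear: "mult2_map K A \<in> linear_maps K (A \<boxtimes>\<^bsub>K\<^esub> (A \<boxtimes>\<^bsub>K\<^esub> A)) A"
  unfolding mult2_map_def
  by (intro linear_maps_o[OF tensor_map_linear mult_map_linear] modules linear_maps_id mult_map_linear)

lemma mult2_first_linear: "mult2_first K A V \<in> linear_maps K (A \<boxtimes>\<^bsub>K\<^esub> (A \<boxtimes>\<^bsub>K\<^esub> AV)) AV"
  unfolding mult2_first_def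
  by (intro linear_maps_o[OF tensor_map_linear] linear_maps_o[OF tensor_unassoc_linear]
      tensor_map_linear modules linear_maps_id mult2_map_linear tensor_unassoc_linear)

lemma mult2_first_pure:
  assumes "a \<in> carrier A" "b \<in> carrier A" "x \<in> carrier AV"
  shows "mult2_first K A V (pure_tensor K A (A \<boxtimes>\<^bsub>K\<^esub> AV) a (pure_tensor K A AV b x)) = a \<rhd> b \<rhd> x"
proof (rule AV_ext[OF AV_module linear_maps_comp[OF linear_maps_comp[OF pure_tensor_linear_right
        pure_tensor_linear_right] mult2_first_linear] linear_maps_comp[OF act_linear_right act_linear_right] _ assms(3)])
  fix c v assume c: "c \<in> carrier A" "v \<in> carrier V"
  have "mult2_map K A (pure_tensor K A (A \<boxtimes>\<^bsub>K\<^esub> A) a (pure_tensor K A A b c)) = a \<otimes>\<^bsub>A\<^esub> (b \<otimes>\<^bsub>A\<^esub> c)"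
    using assms c by (simp add: mult2_map_def tensor_map_pure[OF _ _ _ _ linear_maps_id mult_map_linear]
      modules pure_tensor_closed mult_map_pure)
  then show "mult2_first K A V (pure_tensor K A (A \<boxtimes>\<^bsub>K\<^esub> AV) a (pure_tensor K A AV b (c \<bullet> v))) = a \<rhd> b \<rhd> c \<bullet> v"
    using assms c unfolding mult2_first_def
    by (simp add: tensor_map_pure[OF _ _ _ _ linear_maps_id tensor_unassoc_linear]
      tensor_map_pure[OF _ _ _ _ mult2_map_linear linear_maps_id] tensor_unassoc_pure modules
      pure_tensor_closed act_elem)
qed (use assms in \<open>simp_all add: modules\<close>)

lemma mult2_first_eq_lext:
  assumes "t \<in> carrier (A \<boxtimes>\<^bsub>K\<^esub> (A \<boxtimes>\<^bsub>K\<^esub> AV))"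
  shows "mult2_first K A V t = lext (mult_first K A V) t"
proof (rule lext_unique[OF _ mult_first_linear mult2_first_linear _ assms])
  fix a s assume a: "a \<in> carrier A" and s: "s \<in> carrier (A \<boxtimes>\<^bsub>K\<^esub> AV)"
  show "mult2_first K A V (pure_tensor K A (A \<boxtimes>\<^bsub>K\<^esub> AV) a s) = a \<rhd> mult_first K A V s"
    by (rule two_modules.tensor_product_ext[OF two_modulesI AV_module
          linear_maps_comp[OF pure_tensor_linear_right mult2_first_linear]
          linear_maps_comp[OF mult_first_linear act_linear_right] _ s])
       (use a in \<open>simp_all add: modules mult2_first_pure\<close>)
qed (simp add: modules)

lemma mult2_first_tensor_map:
  assumes "module K U" "h \<in> linear_maps K U AV" "t \<in> carrier (A \<boxtimes>\<^bsub>K\<^esub> (A \<boxtimes>\<^bsub>K\<^esub> U))"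
  shows "mult2_first K A V (tensor_map K A (A \<boxtimes>\<^bsub>K\<^esub> AV) id (tensor_map K A AV id h) t) = lext (lext h) t"
proof -
  note h = tensor_map_linear[OF modules(1) assms(1) modules(1) AV_module linear_maps_id assms(2)]
  note h2 = tensor_map_linear[OF modules(1) _ modules(1) _ linear_maps_id h]
  have "tensor_map K A (A \<boxtimes>\<^bsub>K\<^esub> AV) id (tensor_map K A AV id h) t \<in> carrier (A \<boxtimes>\<^bsub>K\<^esub> (A \<boxtimes>\<^bsub>K\<^esub> AV))"
    using assms by (intro linear_maps_closed[OF h2]) (simp_all add: modules)
  then show ?thesis
    using assms by (simp add: mult2_first_eq_lext lext_tensor_map[OF _ _ mult_first_linear h] modules
      left_extension_def[symmetric])
qed

text \<open>
  By associativity of \<open>A\<close>, multiplying two left factors first and acting afterwards is the same as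
  acting twice. This reduces the factor \<open>(\<mu> \<otimes> id) \<circ> (\<mu> \<otimes> \<sigma>')\<close> of condition (vi) to extensions.
\<close>

lemma mult_tensor_map_unassoc:
  assumes "module K U" "f \<in> linear_maps K U AV" "t \<in> carrier (A \<boxtimes>\<^bsub>K\<^esub> (A \<boxtimes>\<^bsub>K\<^esub> U))"
  shows "mult_first K A V (tensor_map K A AV (mult_map K A) f (tensor_unassoc K A A U t)) = lext (lext f) t"
proof -
  note m = tensor_map_linear[OF _ assms(1) modules(1) AV_module mult_map_linear assms(2)]
  note lin = linear_maps_comp[OF tensor_unassoc_linear linear_maps_comp[OF m mult_first_linear]]
  show ?thesis
  proof (rule lext_unique[OF _ lext_linear[OF assms(1,2)] lin _ assms(3)])
    fix a s assume a: "a \<in> carrier A" and s: "s \<in> carrier (A \<boxtimes>\<^bsub>K\<^esub> U)"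
    show "mult_first K A V (tensor_map K A AV (mult_map K A) f
        (tensor_unassoc K A A U (pure_tensor K A (A \<boxtimes>\<^bsub>K\<^esub> U) a s))) = a \<rhd> lext f s"
      by (rule two_modules.tensor_product_ext[OF two_modulesI AV_module
            linear_maps_comp[OF pure_tensor_linear_right lin]
            linear_maps_comp[OF lext_linear act_linear_right] _ s])
         (use a assms in \<open>simp_all add: modules tensor_unassoc_pure pure_tensor_closed mult_map_pure
            tensor_map_pure[OF _ _ _ _ mult_map_linear assms(2)] lext_pure act_mult linear_maps_closed[of f]\<close>)
  qed (simp_all add: modules assms)
qed

end


section \<open>Multiplication in a crossed product\<close>

sublocale crossed_product_data \<subseteq> algebra_with_module K A V
  by unfold_locales

context crossed_product_data
begin

abbreviation cmult (infixl "\<star>" 70) where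
  "x \<star> y \<equiv> crossed_mult K A V R \<sigma> (pure_tensor K AV AV x y)"

lemma R_first_linear:
  "tensor_first K V A A V V R \<in> linear_maps K (V \<boxtimes>\<^bsub>K\<^esub> AV) (A \<boxtimes>\<^bsub>K\<^esub> (V \<boxtimes>\<^bsub>K\<^esub> V))"
  by (rule tensor_first_linear) (simp_all add: modules R_linear)

lemma R_pure_linear: "a \<in> carrier A \<Longrightarrow> (\<lambda>v. R (pure_tensor K V A v a)) \<in> linear_maps K V AV"
  by (intro linear_maps_comp[OF pure_tensor_linear_left R_linear] modules)

lemma \<sigma>_pure_linear: "w \<in> carrier V \<Longrightarrow> (\<lambda>v. \<sigma> (pure_tensor K V V v w)) \<in> linear_maps K V AV"
  by (intro linear_maps_comp[OF pure_tensor_linear_left \<sigma>_linear] modules)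

lemma crossed_mult_linear: "crossed_mult K A V R \<sigma> \<in> linear_maps K (AV \<boxtimes>\<^bsub>K\<^esub> AV) AV"
  unfolding crossed_mult_def
  by (intro linear_maps_o[OF tensor_assoc_linear] linear_maps_o[OF tensor_map_linear]
      mult2_first_linear tensor_map_linear R_first_linear \<sigma>_linear linear_maps_id modules)

lemma cmult_linear_left: "y \<in> carrier AV \<Longrightarrow> (\<lambda>x. x \<star> y) \<in> linear_maps K AV AV"
  by (intro linear_maps_comp[OF pure_tensor_linear_left crossed_mult_linear] modules)

lemma cmult_linear_right: "x \<in> carrier AV \<Longrightarrow> (\<lambda>y. x \<star> y) \<in> linear_maps K AV AV"
  by (intro linear_maps_comp[OF pure_tensor_linear_right crossed_mult_linear] modules)

lemma cmult_closed: "x \<in> carrier AV \<Longrightarrow> y \<in> carrier AV \<Longrightarrow> x \<star> y \<in> carrier AV"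
  by (rule linear_maps_closed[OF cmult_linear_left])

lemma cmult_eq_lext:
  assumes "x \<in> carrier AV" "y \<in> carrier AV"
  shows "x \<star> y = lext (\<lambda>v. lext \<sigma> (tensor_first K V A A V V R (pure_tensor K V AV v y))) x"
proof -
  let ?s = "tensor_assoc K A V AV (pure_tensor K AV AV x y)"
  note s = linear_maps_closed[OF tensor_assoc_linear[OF A_module V_module AV_module], of "pure_tensor K AV AV x y"]
  note rs = linear_maps_closed[OF tensor_map_linear[OF A_module _ A_module _ linear_maps_id R_first_linear], of ?s]
  note l = lext_linear[OF _ \<sigma>_linear]
  have "x \<star> y = lext (lext \<sigma>) (tensor_map K A (A \<boxtimes>\<^bsub>K\<^esub> (V \<boxtimes>\<^bsub>K\<^esub> V)) id (tensor_first K V A A V V R) ?s)"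
    unfolding crossed_mult_def comp_apply
    by (rule mult2_first_tensor_map[OF _ \<sigma>_linear]) (use assms in \<open>simp_all add: modules \<sigma>_linear pure_tensor_closed rs s\<close>)
  also have "\<dots> = lext (\<lambda>u. lext \<sigma> (tensor_first K V A A V V R u)) ?s"
    by (rule lext_tensor_map[OF _ _ l R_first_linear]) (use assms in \<open>simp_all add: modules pure_tensor_closed s\<close>)
  also have "\<dots> = lext (\<lambda>v. lext \<sigma> (tensor_first K V A A V V R (pure_tensor K V AV v y))) x"
    by (rule lext_assoc) (use assms in \<open>simp_all add: modules linear_maps_comp[OF R_first_linear l]\<close>)
  finally show ?thesis .
qed

lemma cmult_act:
  assumes "a \<in> carrier A" "x \<in> carrier AV" "y \<in> carrier AV"
  shows "(a \<rhd> x) \<star> y = a \<rhd> x \<star> y"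
proof -
  have "(\<lambda>v. lext \<sigma> (tensor_first K V A A V V R (pure_tensor K V AV v y))) \<in> linear_maps K V AV"
    using assms by (intro linear_maps_comp[OF pure_tensor_linear_left linear_maps_comp[OF R_first_linear
      lext_linear[OF _ \<sigma>_linear]]] modules)
  then show ?thesis using assms by (simp add: cmult_eq_lext act_closed lext_act)
qed

text \<open>
  Right multiplication by \<open>a \<otimes> w\<close> is the left \<open>A\<close>-linear extension of \<open>v \<mapsto> R (v \<otimes> a)\<close> followed by
  that of \<open>v \<mapsto> \<sigma> (v \<otimes> w)\<close>. By the unit axioms the first extension alone is right multiplication by
  \<open>a \<otimes> 1\<^sub>V\<close>, and the second alone right multiplication by \<open>1 \<otimes> w\<close>.
\<close>

lemma cmult_elem:
  assumes "x \<in> carrier AV" "a \<in> carrier A" "w \<in> carrier V"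
  shows "x \<star> (a \<bullet> w) = lext (\<lambda>v. \<sigma> (pure_tensor K V V v w)) (lext (\<lambda>v. R (pure_tensor K V A v a)) x)"
proof -
  have *: "lext \<sigma> (tensor_first K V A A V V R (pure_tensor K V AV v (a \<bullet> w))) =
      lext (\<lambda>v. \<sigma> (pure_tensor K V V v w)) (R (pure_tensor K V A v a))" if "v \<in> carrier V" for v
    using assms that
    by (simp add: tensor_first_pure modules R_linear lext_assoc[OF _ \<sigma>_linear] linear_maps_closed[OF R_pure_linear])
  have "x \<star> (a \<bullet> w) = lext (\<lambda>v. lext (\<lambda>v. \<sigma> (pure_tensor K V V v w)) (R (pure_tensor K V A v a))) x"
    using assms
    by (simp add: cmult_eq_lext elem_closed) (rule lext_cong[OF V_module linear_maps_comp[OF R_pure_linear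
      lext_linear[OF V_module \<sigma>_pure_linear]]], simp_all add: *)
  then show ?thesis
    using assms by (simp add: lext_lext[OF V_module R_pure_linear \<sigma>_pure_linear])
qed

lemma cmult_unitV:
  assumes "x \<in> carrier AV" "a \<in> carrier A"
  shows "x \<star> (a \<bullet> unitV) = lext (\<lambda>v. R (pure_tensor K V A v a)) x"
proof -
  have "lext (\<lambda>v. \<sigma> (pure_tensor K V V v unitV)) y = y" if y: "y \<in> carrier AV" for y
    using lext_cong[OF V_module pure_tensor_linear_right y, of "\<one>\<^bsub>A\<^esub>"] \<sigma>_unit_right
    by (simp add: modules lext_unit y)
  then show ?thesis using assms
    by (simp add: cmult_elem unitV_closed lext_closed[OF V_module R_pure_linear])
qed

lemma cmult_one:
  assumes "x \<in> carrier AV" "w \<in> carrier V"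
  shows "x \<star> (\<one>\<^bsub>A\<^esub> \<bullet> w) = lext (\<lambda>v. \<sigma> (pure_tensor K V V v w)) x"
proof -
  have "lext (\<lambda>v. R (pure_tensor K V A v \<one>\<^bsub>A\<^esub>)) x = x"
    using lext_cong[OF V_module pure_tensor_linear_right assms(1), of "\<one>\<^bsub>A\<^esub>"] R_unitA
    by (simp add: modules lext_unit assms)
  then show ?thesis using assms by (simp add: cmult_elem)
qed

lemma R_eq_cmult:
  assumes "v \<in> carrier V" "a \<in> carrier A"
  shows "R (pure_tensor K V A v a) = (\<one>\<^bsub>A\<^esub> \<bullet> v) \<star> (a \<bullet> unitV)"
  using assms
  by (simp add: cmult_unitV elem_closed lext_pure[OF V_module R_pure_linear] act_one linear_maps_closed[OF R_pure_linear])

lemma \<sigma>_eq_cmult: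
  assumes "v \<in> carrier V" "w \<in> carrier V"
  shows "\<sigma> (pure_tensor K V V v w) = (\<one>\<^bsub>A\<^esub> \<bullet> v) \<star> (\<one>\<^bsub>A\<^esub> \<bullet> w)"
  using assms
  by (simp add: cmult_one elem_closed lext_pure[OF V_module \<sigma>_pure_linear] act_one linear_maps_closed[OF \<sigma>_pure_linear])

text \<open>
  Right multiplication by \<open>a \<otimes> w = (a \<otimes> 1\<^sub>V) \<star> (1 \<otimes> w)\<close> can be done in two steps. This reduces
  questions about products to right factors in \<open>A \<otimes> 1\<^sub>V\<close> and in \<open>1 \<otimes> V\<close>.
\<close>

lemma cmult_elem_factor:
  assumes "x \<in> carrier AV" "a \<in> carrier A" "w \<in> carrier V"
  shows "x \<star> (a \<bullet> w) = x \<star> (a \<bullet> unitV) \<star> (\<one>\<^bsub>A\<^esub> \<bullet> w)"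
  using assms
  by (simp add: cmult_elem[of x a w] cmult_one cmult_unitV lext_closed[OF V_module R_pure_linear])

lemma unitV_cmult:
  assumes "a \<in> carrier A" "x \<in> carrier AV"
  shows "(a \<bullet> unitV) \<star> x = a \<rhd> x"
proof (rule AV_ext[OF AV_module cmult_linear_right act_linear_right _ assms(2)])
  fix b w assume b: "b \<in> carrier A" "w \<in> carrier V"
  have "(a \<bullet> unitV) \<star> (b \<bullet> w) = (a \<rhd> b \<bullet> unitV) \<star> (\<one>\<^bsub>A\<^esub> \<bullet> w)"
    using assms b by (subst cmult_elem_factor)
      (simp_all add: elem_closed unitV_closed cmult_unitV lext_pure[OF V_module R_pure_linear] R_unitV)
  also have "\<dots> = a \<rhd> b \<bullet> w"
    using assms b by (simp add: act_elem unitV_closed cmult_one elem_closed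
      lext_pure[OF V_module \<sigma>_pure_linear] \<sigma>_unit_left act_one_elem)
  finally show "(a \<bullet> unitV) \<star> (b \<bullet> w) = a \<rhd> b \<bullet> w" .
qed (simp_all add: assms elem_closed unitV_closed)

text \<open>
  This is the compatibility of \<open>R\<close> with the multiplication of \<open>A\<close>, extended left \<open>A\<close>-linearly from
  \<open>1 \<otimes> v\<close> to all \<open>x\<close>.
\<close>

lemma cmult_unitV_mult:
  assumes "x \<in> carrier AV" "a \<in> carrier A" "b \<in> carrier A"
  shows "x \<star> ((a \<otimes>\<^bsub>A\<^esub> b) \<bullet> unitV) = x \<star> (a \<bullet> unitV) \<star> (b \<bullet> unitV)"
proof -
  have *: "R (pure_tensor K V A v (a \<otimes>\<^bsub>A\<^esub> b)) =
      lext (\<lambda>v. R (pure_tensor K V A v b)) (R (pure_tensor K V A v a))" if v: "v \<in> carrier V" for v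
  proof -
    let ?t = "pure_tensor K V (A \<boxtimes>\<^bsub>K\<^esub> A) v (pure_tensor K A A a b)"
    have "R (pure_tensor K V A v (a \<otimes>\<^bsub>A\<^esub> b)) = (R \<circ> tensor_map K V A id (mult_map K A)) ?t"
      using v assms by (simp add: tensor_map_pure[OF _ _ _ _ linear_maps_id mult_map_linear] modules
        pure_tensor_closed mult_map_pure)
    also have "\<dots> = lext R (tensor_first K V A A V A R ?t)"
      using R_mult[of ?t] v assms by (simp add: modules pure_tensor_closed left_extension_def)
    also have "\<dots> = lext (\<lambda>v. R (pure_tensor K V A v b)) (R (pure_tensor K V A v a))"
      using v assms by (simp add: tensor_first_pure modules R_linear lext_assoc[OF _ R_linear]
        linear_maps_closed[OF R_pure_linear])
    finally show ?thesis .
  qed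
  have "x \<star> ((a \<otimes>\<^bsub>A\<^esub> b) \<bullet> unitV) =
      lext (\<lambda>v. lext (\<lambda>v. R (pure_tensor K V A v b)) (R (pure_tensor K V A v a))) x"
    using assms by (simp add: cmult_unitV) (rule lext_cong[OF V_module linear_maps_comp[OF R_pure_linear
      lext_linear[OF V_module R_pure_linear]]], simp_all add: *)
  then show ?thesis using assms
    by (simp add: cmult_unitV lext_closed[OF V_module R_pure_linear] lext_lext[OF V_module R_pure_linear R_pure_linear])
qed

text \<open>
  Associativity of the crossed product with middle factor in \<open>A \<otimes> 1\<^sub>V\<close>.
\<close>

lemma cmult_act_right:
  assumes "x \<in> carrier AV" "a \<in> carrier A" "y \<in> carrier AV"
  shows "x \<star> (a \<rhd> y) = x \<star> (a \<bullet> unitV) \<star> y"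
proof (rule AV_ext[OF AV_module linear_maps_comp[OF act_linear_right cmult_linear_right] cmult_linear_right _ assms(3)])
  fix b w assume b: "b \<in> carrier A" "w \<in> carrier V"
  then show "x \<star> (a \<rhd> b \<bullet> w) = x \<star> (a \<bullet> unitV) \<star> (b \<bullet> w)"
    using assms cmult_elem_factor[of x "a \<otimes>\<^bsub>A\<^esub> b" w] cmult_elem_factor[of "x \<star> (a \<bullet> unitV)" b w]
    by (simp add: act_elem cmult_unitV_mult cmult_closed elem_closed unitV_closed)
qed (simp_all add: assms elem_closed unitV_closed cmult_closed)

lemma lext_cmult:
  assumes "f \<in> linear_maps K V AV" "x \<in> carrier AV" "y \<in> carrier AV"
  shows "lext f x \<star> y = lext (\<lambda>v. f v \<star> y) x"
  by (rule lext_unique[OF V_module linear_maps_comp[OF assms(1) cmult_linear_left]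
        linear_maps_comp[OF lext_linear cmult_linear_left] _ assms(2)])
     (use assms in \<open>simp_all add: V_module lext_pure cmult_act linear_maps_closed[of f]\<close>)

end


section \<open>The conditions as identities between products\<close>

context crossed_product_data
begin

lemma crossed_product_simps:
  "carrier (crossed_product K A V unitV R \<sigma>) = carrier AV"
  "x \<oplus>\<^bsub>crossed_product K A V unitV R \<sigma>\<^esub> y = x \<oplus>\<^bsub>AV\<^esub> y"
  "c \<odot>\<^bsub>crossed_product K A V unitV R \<sigma>\<^esub> x = c \<odot>\<^bsub>AV\<^esub> x"
  "x \<otimes>\<^bsub>crossed_product K A V unitV R \<sigma>\<^esub> y = x \<star> y"
  "\<one>\<^bsub>crossed_product K A V unitV R \<sigma>\<^esub> = \<one>\<^bsub>A\<^esub> \<bullet> unitV"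
  by (simp_all add: crossed_product_def)

text \<open>
  The right-hand side of condition (i).
\<close>

lemma twisting_transform_pure:
  assumes "\<theta> \<in> linear_maps K V AV" "\<gamma> \<in> linear_maps K V AV" "v \<in> carrier V" "a \<in> carrier A"
  shows "mult2_first K A V (tensor_map K A (A \<boxtimes>\<^bsub>K\<^esub> AV) id (tensor_map K A AV id \<gamma>)
      (tensor_map K A AV id R (tensor_assoc K A V A
        (tensor_map K AV A \<theta> id (pure_tensor K V A v a))))) = lext \<gamma> (\<theta> v \<star> (a \<bullet> unitV))"
proof -
  let ?s = "tensor_assoc K A V A (pure_tensor K AV A (\<theta> v) a)"
  note \<theta> = linear_maps_closed[OF assms(1)]
  have s: "?s \<in> carrier (A \<boxtimes>\<^bsub>K\<^esub> (V \<boxtimes>\<^bsub>K\<^esub> A))"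
    by (rule linear_maps_closed[OF tensor_assoc_linear]) (use assms in \<open>simp_all add: modules pure_tensor_closed \<theta>\<close>)
  have "tensor_map K A AV id R ?s \<in> carrier (A \<boxtimes>\<^bsub>K\<^esub> AV)"
    by (rule linear_maps_closed[OF tensor_map_linear[OF _ _ _ _ linear_maps_id R_linear] s]) (simp_all add: modules)
  then have "mult2_first K A V (tensor_map K A (A \<boxtimes>\<^bsub>K\<^esub> AV) id (tensor_map K A AV id \<gamma>)
      (tensor_map K A AV id R ?s)) = lext (\<lambda>u. lext \<gamma> (R u)) ?s"
    using s by (simp add: mult2_first_tensor_map[OF V_module assms(2)] modules
      lext_tensor_map[OF _ _ lext_linear[OF V_module assms(2)] R_linear])
  also have "\<dots> = lext (\<lambda>v. lext \<gamma> (R (pure_tensor K V A v a))) (\<theta> v)"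
    using assms by (intro lext_assoc linear_maps_comp[OF R_linear] lext_linear modules \<theta>)
  also have "\<dots> = lext \<gamma> (\<theta> v \<star> (a \<bullet> unitV))"
    using assms by (simp add: \<theta> cmult_unitV lext_lext[OF V_module R_pure_linear])
  finally show ?thesis
    using assms by (simp add: tensor_map_pure[OF _ _ _ _ assms(1) linear_maps_id] modules)
qed

lemma twisting_transform_linear:
  assumes "\<theta> \<in> linear_maps K V AV" "\<gamma> \<in> linear_maps K V AV"
  shows "mult2_first K A V \<circ> tensor_map K A (A \<boxtimes>\<^bsub>K\<^esub> AV) id (tensor_map K A AV id \<gamma>) \<circ>
    tensor_map K A AV id R \<circ> (tensor_assoc K A V A \<circ> tensor_map K AV A \<theta> id)
    \<in> linear_maps K (V \<boxtimes>\<^bsub>K\<^esub> A) AV"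
  by (intro linear_maps_o[OF tensor_map_linear] linear_maps_o[OF linear_maps_o[OF tensor_map_linear tensor_assoc_linear]]
      mult2_first_linear tensor_map_linear R_linear linear_maps_id modules assms)

text \<open>
  The right-hand side of condition (ii): all factors between \<open>lext \<gamma>\<close> and \<open>\<theta> \<otimes> \<theta>\<close> make up the
  multiplication of the crossed product.
\<close>

lemma cocycle_transform_linear:
  assumes "\<theta> \<in> linear_maps K V AV" "\<gamma> \<in> linear_maps K V AV"
  shows "(\<lambda>t. lext \<gamma> (crossed_mult K A V R \<sigma> (tensor_map K AV AV \<theta> \<theta> t))) \<in> linear_maps K (V \<boxtimes>\<^bsub>K\<^esub> V) AV"
  by (intro linear_maps_comp[OF tensor_map_linear] linear_maps_comp[OF crossed_mult_linear]
      lext_linear linear_maps_id modules assms)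

end

locale crossed_product_pair = crossed_product_data K A V unitV R \<sigma> +
    D: crossed_product_data K A V unitV R' \<sigma>'
  for K :: "'k ring" and A :: "('k, 'a) module" and V :: "('k, 'v) module" and unitV R \<sigma> R' \<sigma>'
begin

notation D.cmult (infixl "\<star>''" 70)

text \<open>
  The left-hand side of condition (vi), which involves \<open>R\<close> from one crossed product and \<open>\<sigma>'\<close> from the
  other.
\<close>

definition mixed_product where
  "mixed_product \<gamma> = mult_first K A V \<circ>
     (tensor_map K A AV (mult_map K A) \<sigma>' \<circ> tensor_unassoc K A A (V \<boxtimes>\<^bsub>K\<^esub> V)) \<circ>
     tensor_map K A (A \<boxtimes>\<^bsub>K\<^esub> (V \<boxtimes>\<^bsub>K\<^esub> V)) id (tensor_assoc K A V V \<circ> tensor_map K AV V \<gamma> id) \<circ>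
     tensor_first K V A A V V R \<circ> tensor_map K V AV id \<gamma>"

lemma mixed_product_linear:
  assumes "\<gamma> \<in> linear_maps K V AV"
  shows "mixed_product \<gamma> \<in> linear_maps K (V \<boxtimes>\<^bsub>K\<^esub> V) AV"
proof -
  have g: "tensor_assoc K A V V \<circ> tensor_map K AV V \<gamma> id
      \<in> linear_maps K (V \<boxtimes>\<^bsub>K\<^esub> V) (A \<boxtimes>\<^bsub>K\<^esub> (V \<boxtimes>\<^bsub>K\<^esub> V))"
    by (intro linear_maps_o[OF tensor_map_linear tensor_assoc_linear] modules assms linear_maps_id)
  have u: "tensor_map K A AV (mult_map K A) \<sigma>' \<circ> tensor_unassoc K A A (V \<boxtimes>\<^bsub>K\<^esub> V)
      \<in> linear_maps K (A \<boxtimes>\<^bsub>K\<^esub> (A \<boxtimes>\<^bsub>K\<^esub> (V \<boxtimes>\<^bsub>K\<^esub> V))) (A \<boxtimes>\<^bsub>K\<^esub> AV)"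
    by (intro linear_maps_o[OF tensor_unassoc_linear] tensor_map_linear mult_map_linear D.\<sigma>_linear modules)
  show ?thesis
    unfolding mixed_product_def
    by (intro linear_maps_o[OF tensor_map_linear] linear_maps_o[OF R_first_linear] linear_maps_o[OF u]
        tensor_map_linear g mult_first_linear linear_maps_id modules assms)
qed

text \<open>
  For \<open>\<gamma> w = \<Sum> a \<otimes> u\<close> the left-hand side of (vi) is \<open>\<Sum> lext \<gamma> (R (v \<otimes> a)) \<star>' (1 \<otimes> u)\<close>. The hypothesis
  turns this into \<open>\<Sum> \<gamma> v \<star>' (a \<otimes> 1\<^sub>V) \<star>' (1 \<otimes> u) = \<gamma> v \<star>' \<gamma> w\<close>. It is stated as a
  hypothesis because the two directions of the theorem obtain it differently: from multiplicativity of
  \<open>\<phi>\<inverse>\<close>, or from (i) and (v).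
\<close>

lemma mixed_product_pure:
  assumes \<gamma>: "\<gamma> \<in> linear_maps K V AV" and v: "v \<in> carrier V" and w: "w \<in> carrier V"
    and rel: "\<And>a. a \<in> carrier A \<Longrightarrow> lext \<gamma> (R (pure_tensor K V A v a)) = \<gamma> v \<star>' (a \<bullet> unitV)"
  shows "mixed_product \<gamma> (pure_tensor K V V v w) = \<gamma> v \<star>' \<gamma> w"
proof -
  let ?g = "tensor_assoc K A V V \<circ> tensor_map K AV V \<gamma> id"
  let ?f = "\<lambda>p. lext \<sigma>' (?g p)"
  note \<gamma>c = linear_maps_closed[OF \<gamma>]
  have g: "?g \<in> linear_maps K (V \<boxtimes>\<^bsub>K\<^esub> V) (A \<boxtimes>\<^bsub>K\<^esub> (V \<boxtimes>\<^bsub>K\<^esub> V))"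
    by (intro linear_maps_o[OF tensor_map_linear tensor_assoc_linear] modules \<gamma> linear_maps_id)
  have f: "?f \<in> linear_maps K (V \<boxtimes>\<^bsub>K\<^esub> V) AV"
    by (rule linear_maps_comp[OF g lext_linear[OF _ D.\<sigma>_linear]]) (simp add: modules)
  note G = linear_maps_comp[OF R_first_linear lext_linear[OF _ f]]
  have "mixed_product \<gamma> (pure_tensor K V V v w) =
      lext ?f (tensor_first K V A A V V R (pure_tensor K V AV v (\<gamma> w)))"
  proof -
    note s = linear_maps_closed[OF R_first_linear, of "pure_tensor K V AV v (\<gamma> w)"]
    note gs = linear_maps_closed[OF tensor_map_linear[OF A_module _ A_module _ linear_maps_id g]]
    let ?s = "tensor_first K V A A V V R (pure_tensor K V AV v (\<gamma> w))"
    have "mixed_product \<gamma> (pure_tensor K V V v w) = mult_first K A V (tensor_map K A AV (mult_map K A) \<sigma>'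
        (tensor_unassoc K A A (V \<boxtimes>\<^bsub>K\<^esub> V) (tensor_map K A (A \<boxtimes>\<^bsub>K\<^esub> (V \<boxtimes>\<^bsub>K\<^esub> V)) id ?g ?s)))"
      using v w by (simp add: mixed_product_def tensor_map_pure[OF _ _ _ _ linear_maps_id \<gamma>] modules)
    also have "\<dots> = lext (lext \<sigma>') (tensor_map K A (A \<boxtimes>\<^bsub>K\<^esub> (V \<boxtimes>\<^bsub>K\<^esub> V)) id ?g ?s)"
      by (rule mult_tensor_map_unassoc[OF _ D.\<sigma>_linear gs]) (use v w in \<open>simp_all add: modules s pure_tensor_closed \<gamma>c\<close>)
    also have "\<dots> = lext ?f ?s"
      by (rule lext_tensor_map[OF _ _ lext_linear[OF _ D.\<sigma>_linear] g])
         (use v w in \<open>simp_all add: modules s pure_tensor_closed \<gamma>c\<close>)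
    finally show ?thesis .
  qed
  also have "\<dots> = \<gamma> v \<star>' \<gamma> w"
    \<comment> \<open>both sides are linear in \<open>\<gamma> w\<close>, which is now replaced by an arbitrary \<open>a \<otimes> u\<close>\<close>
  proof (rule AV_ext[OF AV_module linear_maps_comp[OF pure_tensor_linear_right G] D.cmult_linear_right _ \<gamma>c[OF w]])
    fix a u assume a: "a \<in> carrier A" and u: "u \<in> carrier V"
    let ?S = "\<lambda>v. \<sigma>' (pure_tensor K V V v u)"
    have Rva: "R (pure_tensor K V A v a) \<in> carrier AV" by (rule linear_maps_closed[OF R_pure_linear[OF a] v])
    have "lext ?f (tensor_first K V A A V V R (pure_tensor K V AV v (a \<bullet> u))) =
        lext (\<lambda>x. ?f (pure_tensor K V V x u)) (R (pure_tensor K V A v a))"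
      using a u v by (simp add: tensor_first_pure modules R_linear lext_assoc[OF _ f, unfolded comp_def] Rva)
    also have "\<dots> = lext (\<lambda>x. lext ?S (\<gamma> x)) (R (pure_tensor K V A v a))"
      by (rule lext_cong[OF V_module linear_maps_comp[OF \<gamma> lext_linear[OF V_module D.\<sigma>_pure_linear]] Rva])
         (use u in \<open>simp_all add: tensor_map_pure[OF _ _ _ _ \<gamma> linear_maps_id] modules lext_assoc[OF _ D.\<sigma>_linear] \<gamma>c\<close>)
    also have "\<dots> = lext ?S (lext \<gamma> (R (pure_tensor K V A v a)))"
      by (rule lext_lext[OF V_module \<gamma> D.\<sigma>_pure_linear Rva, symmetric]) (rule u)
    also have "\<dots> = \<gamma> v \<star>' (a \<bullet> unitV) \<star>' (\<one>\<^bsub>A\<^esub> \<bullet> u)"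
      using a u v by (simp add: rel D.cmult_one D.cmult_closed \<gamma>c elem_closed unitV_closed)
    also have "\<dots> = \<gamma> v \<star>' (a \<bullet> u)"
      using a u v by (simp add: D.cmult_elem_factor[of "\<gamma> v" a u] \<gamma>c)
    finally show "lext ?f (tensor_first K V A A V V R (pure_tensor K V AV v (a \<bullet> u))) = \<gamma> v \<star>' (a \<bullet> u)" .
  qed (simp_all add: modules v \<gamma>c)
  finally show ?thesis .
qed

text \<open>
  Conditions (i)-(vi) on pure tensors, with the right-hand sides of (i) and (ii) written as products.
\<close>

definition equivalence_maps where
  "equivalence_maps \<theta> \<gamma> \<longleftrightarrow>
    (\<forall>v \<in> carrier V. \<forall>a \<in> carrier A. R' (pure_tensor K V A v a) = lext \<gamma> (\<theta> v \<star> (a \<bullet> unitV))) \<and>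
    (\<forall>v \<in> carrier V. \<forall>w \<in> carrier V. \<sigma>' (pure_tensor K V V v w) = lext \<gamma> (\<theta> v \<star> \<theta> w)) \<and>
    \<theta> unitV = \<one>\<^bsub>A\<^esub> \<bullet> unitV \<and> \<gamma> unitV = \<one>\<^bsub>A\<^esub> \<bullet> unitV \<and>
    (\<forall>v \<in> carrier V. lext \<gamma> (\<theta> v) = \<one>\<^bsub>A\<^esub> \<bullet> v) \<and>
    (\<forall>v \<in> carrier V. lext \<theta> (\<gamma> v) = \<one>\<^bsub>A\<^esub> \<bullet> v) \<and>
    (\<forall>v \<in> carrier V. \<forall>w \<in> carrier V.
      mixed_product \<gamma> (pure_tensor K V V v w) = lext \<gamma> (\<sigma> (pure_tensor K V V v w)))"

text \<open>
  Both sides of each condition are linear, so it suffices to compare them on pure tensors.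
\<close>

lemma twisting_condition_iff:
  assumes "\<theta> \<in> linear_maps K V AV" "\<gamma> \<in> linear_maps K V AV"
  shows "(\<forall>t \<in> carrier (V \<boxtimes>\<^bsub>K\<^esub> A). R' t =
      (mult2_first K A V \<circ> tensor_map K A (A \<boxtimes>\<^bsub>K\<^esub> AV) id (tensor_map K A AV id \<gamma>) \<circ>
       tensor_map K A AV id R \<circ> (tensor_assoc K A V A \<circ> tensor_map K AV A \<theta> id)) t) \<longleftrightarrow>
    (\<forall>v \<in> carrier V. \<forall>a \<in> carrier A. R' (pure_tensor K V A v a) = lext \<gamma> (\<theta> v \<star> (a \<bullet> unitV)))"
  using two_modules.tensor_product_ext[OF two_modulesI[OF V_module A_module] AV_module D.R_linear
      twisting_transform_linear[OF assms]]
  by (auto simp: twisting_transform_pure[OF assms] pure_tensor_closed modules)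

lemma cocycle_condition_iff:
  assumes "\<theta> \<in> linear_maps K V AV" "\<gamma> \<in> linear_maps K V AV"
  shows "(\<forall>t \<in> carrier (V \<boxtimes>\<^bsub>K\<^esub> V). \<sigma>' t =
      lext \<gamma> (crossed_mult K A V R \<sigma> (tensor_map K AV AV \<theta> \<theta> t))) \<longleftrightarrow>
    (\<forall>v \<in> carrier V. \<forall>w \<in> carrier V. \<sigma>' (pure_tensor K V V v w) = lext \<gamma> (\<theta> v \<star> \<theta> w))"
  using two_modules.tensor_product_ext[OF two_modulesI[OF V_module V_module] AV_module D.\<sigma>_linear
      cocycle_transform_linear[OF assms]]
  by (auto simp: tensor_map_pure[OF _ _ _ _ assms(1) assms(1)] pure_tensor_closed modules)

lemma mixed_condition_iff:
  assumes "\<gamma> \<in> linear_maps K V AV"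
  shows "(\<forall>t \<in> carrier (V \<boxtimes>\<^bsub>K\<^esub> V). mixed_product \<gamma> t = lext \<gamma> (\<sigma> t)) \<longleftrightarrow>
    (\<forall>v \<in> carrier V. \<forall>w \<in> carrier V.
      mixed_product \<gamma> (pure_tensor K V V v w) = lext \<gamma> (\<sigma> (pure_tensor K V V v w)))"
  using two_modules.tensor_product_ext[OF two_modulesI[OF V_module V_module] AV_module
      mixed_product_linear[OF assms] linear_maps_comp[OF \<sigma>_linear lext_linear[OF V_module assms]]]
  by (auto simp: pure_tensor_closed modules)


section \<open>Isomorphisms of crossed products\<close>

text \<open>
  The product \<open>x \<star> (b \<otimes> w)\<close> arises from \<open>x\<close> by right multiplication with \<open>b \<otimes> 1\<^sub>V\<close> and then with
  \<open>1 \<otimes> w\<close>, so it is enough that \<open>lext \<gamma>\<close> carries these two right multiplications to those by \<open>b \<otimes> 1\<^sub>V\<close>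
  and by \<open>\<gamma> w\<close>. The first comes from (i) and (v), the second from (vi).
\<close>

lemma lext_multiplicative:
  assumes \<theta>: "\<theta> \<in> linear_maps K V AV" and \<gamma>: "\<gamma> \<in> linear_maps K V AV"
    and R': "\<And>v a. v \<in> carrier V \<Longrightarrow> a \<in> carrier A \<Longrightarrow>
      R' (pure_tensor K V A v a) = lext \<gamma> (\<theta> v \<star> (a \<bullet> unitV))"
    and \<theta>\<gamma>: "\<And>v. v \<in> carrier V \<Longrightarrow> lext \<theta> (\<gamma> v) = \<one>\<^bsub>A\<^esub> \<bullet> v"
    and mixed: "\<And>v w. v \<in> carrier V \<Longrightarrow> w \<in> carrier V \<Longrightarrow>
      mixed_product \<gamma> (pure_tensor K V V v w) = lext \<gamma> (\<sigma> (pure_tensor K V V v w))"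
    and x: "x \<in> carrier AV" and y: "y \<in> carrier AV"
  shows "lext \<gamma> (x \<star> y) = lext \<gamma> x \<star>' lext \<gamma> y"
proof -
  note closed = elem_closed unitV_closed linear_maps_closed[OF \<theta>] linear_maps_closed[OF \<gamma>]
    lext_closed[OF V_module \<theta>] lext_closed[OF V_module \<gamma>] cmult_closed D.cmult_closed
  \<comment> \<open>(i) extends left \<open>A\<close>-linearly to \<open>x \<star>' (a \<otimes> 1\<^sub>V) = lext \<gamma> (lext \<theta> x \<star> (a \<otimes> 1\<^sub>V))\<close>; by (v), \<open>lext \<theta>\<close>
    maps \<open>x = \<gamma> v\<close> to \<open>1 \<otimes> v\<close>\<close>
  have \<gamma>R: "lext \<gamma> (R (pure_tensor K V A v a)) = \<gamma> v \<star>' (a \<bullet> unitV)"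
    if v: "v \<in> carrier V" and a: "a \<in> carrier A" for v a
  proof -
    have "\<gamma> v \<star>' (a \<bullet> unitV) = lext (\<lambda>v. lext \<gamma> (\<theta> v \<star> (a \<bullet> unitV))) (\<gamma> v)"
      using v a by (simp add: D.cmult_unitV closed)
        (rule lext_cong[OF V_module linear_maps_comp[OF linear_maps_comp[OF \<theta> cmult_linear_left]
          lext_linear[OF V_module \<gamma>]]], simp_all add: closed R')
    also have "\<dots> = lext \<gamma> (lext \<theta> (\<gamma> v) \<star> (a \<bullet> unitV))"
      using v a by (simp add: lext_cmult[OF \<theta>] closed
        lext_lext[OF V_module linear_maps_comp[OF \<theta> cmult_linear_left] \<gamma>])
    finally show ?thesis using v a by (simp add: \<theta>\<gamma> R_eq_cmult)
  qed
  have \<gamma>\<sigma>: "lext \<gamma> (\<sigma> (pure_tensor K V V v w)) = \<gamma> v \<star>' \<gamma> w" if "v \<in> carrier V" "w \<in> carrier V" for v w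
    using mixed_product_pure[OF \<gamma> that \<gamma>R] mixed that by simp
  have mult_A: "lext \<gamma> (z \<star> (a \<bullet> unitV)) = lext \<gamma> z \<star>' (a \<bullet> unitV)"
    if z: "z \<in> carrier AV" and a: "a \<in> carrier A" for z a
    using z a by (simp add: cmult_unitV lext_lext[OF V_module R_pure_linear \<gamma>] D.lext_cmult[OF \<gamma>] closed)
      (rule lext_cong[OF V_module linear_maps_comp[OF \<gamma> D.cmult_linear_left]], simp_all add: closed \<gamma>R)
  have mult_V: "lext \<gamma> (z \<star> (\<one>\<^bsub>A\<^esub> \<bullet> w)) = lext \<gamma> z \<star>' \<gamma> w"
    if z: "z \<in> carrier AV" and w: "w \<in> carrier V" for z w
    using z w by (simp add: cmult_one lext_lext[OF V_module \<sigma>_pure_linear \<gamma>] D.lext_cmult[OF \<gamma>] closed)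
      (rule lext_cong[OF V_module linear_maps_comp[OF \<gamma> D.cmult_linear_left]], simp_all add: closed \<gamma>\<sigma>)
  show ?thesis
  proof (rule AV_ext[OF AV_module linear_maps_comp[OF cmult_linear_right lext_linear[OF V_module \<gamma>]]
        linear_maps_comp[OF lext_linear[OF V_module \<gamma>] D.cmult_linear_right] _ y])
    fix b w assume b: "b \<in> carrier A" and w: "w \<in> carrier V"
    have "lext \<gamma> (x \<star> (b \<bullet> w)) = lext \<gamma> (x \<star> (b \<bullet> unitV) \<star> (\<one>\<^bsub>A\<^esub> \<bullet> w))"
      using cmult_elem_factor[OF x b w] by simp
    also have "\<dots> = lext \<gamma> x \<star>' (b \<bullet> unitV) \<star>' \<gamma> w"
      using x b w by (simp add: mult_V mult_A closed)
    also have "\<dots> = lext \<gamma> x \<star>' lext \<gamma> (b \<bullet> w)"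
      using x b w by (simp add: D.cmult_act_right closed lext_pure[OF V_module \<gamma>])
    finally show "lext \<gamma> (x \<star> (b \<bullet> w)) = lext \<gamma> x \<star>' lext \<gamma> (b \<bullet> w)" .
  qed (use x in \<open>simp_all add: closed\<close>)
qed

lemma lext_inverse:
  assumes f: "f \<in> linear_maps K V AV" and g: "g \<in> linear_maps K V AV"
    and "\<And>v. v \<in> carrier V \<Longrightarrow> lext g (f v) = \<one>\<^bsub>A\<^esub> \<bullet> v" and x: "x \<in> carrier AV"
  shows "lext g (lext f x) = x"
proof -
  have "lext g (lext f x) = lext (\<lambda>v. \<one>\<^bsub>A\<^esub> \<bullet> v) x"
    by (simp add: lext_lext[OF V_module f g x])
      (rule lext_cong[OF V_module pure_tensor_linear_right x], simp_all add: modules assms)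
  then show ?thesis by (simp add: lext_unit x)
qed

text \<open>
  \<open>lext \<theta>\<close> is multiplicative as the inverse of \<open>lext \<gamma>\<close>, and it fixes \<open>A \<otimes> 1\<^sub>V\<close> because \<open>\<theta>\<close> preserves
  the unit.
\<close>

lemma isomorphism_of_maps:
  assumes \<theta>: "\<theta> \<in> linear_maps K V AV" and \<gamma>: "\<gamma> \<in> linear_maps K V AV"
    and maps: "equivalence_maps \<theta> \<gamma>"
  shows "equivalent_crossed_products K A V unitV R \<sigma> R' \<sigma>'"
proof -
  have R': "R' (pure_tensor K V A v a) = lext \<gamma> (\<theta> v \<star> (a \<bullet> unitV))"
    if "v \<in> carrier V" "a \<in> carrier A" for v a
    using maps that by (simp add: equivalence_maps_def)
  have \<theta>_unit: "\<theta> unitV = \<one>\<^bsub>A\<^esub> \<bullet> unitV"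
    using maps by (simp add: equivalence_maps_def)
  have \<gamma>\<theta>: "lext \<gamma> (\<theta> v) = \<one>\<^bsub>A\<^esub> \<bullet> v" and \<theta>\<gamma>: "lext \<theta> (\<gamma> v) = \<one>\<^bsub>A\<^esub> \<bullet> v" if "v \<in> carrier V" for v
    using maps that by (simp_all add: equivalence_maps_def)
  have mixed: "mixed_product \<gamma> (pure_tensor K V V v w) = lext \<gamma> (\<sigma> (pure_tensor K V V v w))"
    if "v \<in> carrier V" "w \<in> carrier V" for v w
    using maps that by (simp add: equivalence_maps_def)
  note \<theta>_lin = lext_linear[OF V_module \<theta>]
  note closed = lext_closed[OF V_module \<theta>] lext_closed[OF V_module \<gamma>]
  note inv = lext_inverse[OF \<theta> \<gamma> \<gamma>\<theta>] lext_inverse[OF \<gamma> \<theta> \<theta>\<gamma>]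
  have unit: "lext \<theta> (a \<bullet> unitV) = a \<bullet> unitV" if "a \<in> carrier A" for a
    using that by (simp add: lext_pure[OF V_module \<theta>] unitV_closed \<theta>_unit act_one_elem)
  have mult: "lext \<theta> (x \<star>' y) = lext \<theta> x \<star> lext \<theta> y" if "x \<in> carrier AV" "y \<in> carrier AV" for x y
  proof -
    have "x \<star>' y = lext \<gamma> (lext \<theta> x \<star> lext \<theta> y)"
      using that by (simp add: lext_multiplicative[OF \<theta> \<gamma> R' \<theta>\<gamma> mixed] closed inv)
    then show ?thesis using that by (simp add: inv closed cmult_closed)
  qed
  have bij: "bij_betw (lext \<theta>) (carrier AV) (carrier AV)"
    by (rule bij_betw_byWitness[of _ "lext \<gamma>"]) (auto simp: inv closed)
  have "lext \<theta> \<in> algebra_isos K (crossed_product K A V unitV R' \<sigma>') (crossed_product K A V unitV R \<sigma>)"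
    using \<theta>_lin bij
    by (simp add: algebra_isos_def ring_iso_def ring_hom_def linear_maps_def Pi_iff
      crossed_product_simps D.crossed_product_simps mult unit)
  with unit show ?thesis unfolding equivalent_crossed_products_def by blast
qed

text \<open>
  The isomorphism and its inverse are left \<open>A\<close>-linear because they are multiplicative and fix \<open>A \<otimes> 1\<^sub>V\<close>,
  so they equal \<open>lext \<theta>\<close> and \<open>lext \<gamma>\<close> for their restrictions \<open>\<theta>\<close> and \<open>\<gamma>\<close> to \<open>1 \<otimes> V\<close>. Conditions (i), (ii) and (vi) are
  then multiplicativity of the inverse on products of two elements of \<open>A \<otimes> V\<close>.
\<close>

lemma maps_of_isomorphism:
  assumes "equivalent_crossed_products K A V unitV R \<sigma> R' \<sigma>'"
  shows "\<exists>\<theta> \<in> linear_maps K V AV. \<exists>\<gamma> \<in> linear_maps K V AV. equivalence_maps \<theta> \<gamma>"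
proof -
  from assms obtain \<phi> where
      \<phi>: "\<phi> \<in> algebra_isos K (crossed_product K A V unitV R' \<sigma>') (crossed_product K A V unitV R \<sigma>)"
    and \<phi>_unit: "\<And>a. a \<in> carrier A \<Longrightarrow> \<phi> (a \<bullet> unitV) = a \<bullet> unitV"
    unfolding equivalent_crossed_products_def by blast
  from \<phi> have \<phi>_lin: "\<phi> \<in> linear_maps K AV AV"
    by (simp add: algebra_isos_def linear_maps_def Pi_iff crossed_product_simps D.crossed_product_simps)
  from \<phi> have bij: "bij_betw \<phi> (carrier AV) (carrier AV)"
    by (simp add: algebra_isos_def ring_iso_def crossed_product_simps D.crossed_product_simps)
  from \<phi> have \<phi>_mult: "\<phi> (x \<star>' y) = \<phi> x \<star> \<phi> y" if "x \<in> carrier AV" "y \<in> carrier AV" for x y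
    using that
    by (simp add: algebra_isos_def ring_iso_def ring_hom_def crossed_product_simps D.crossed_product_simps)
  define \<psi> where "\<psi> = inv_into (carrier AV) \<phi>"
  have \<psi>_lin: "\<psi> \<in> linear_maps K AV AV"
    unfolding \<psi>_def by (rule linear_maps_inv_into[OF AV_module \<phi>_lin bij])
  note closed = linear_maps_closed[OF \<phi>_lin] linear_maps_closed[OF \<psi>_lin] elem_closed unitV_closed
    act_closed cmult_closed D.cmult_closed
  have \<psi>\<phi>: "\<psi> (\<phi> x) = x" and \<phi>\<psi>: "\<phi> (\<psi> x) = x" if "x \<in> carrier AV" for x
    using bij_betw_inv_into_left[OF bij that] bij_betw_inv_into_right[OF bij that] by (simp_all add: \<psi>_def)
  have \<psi>_mult: "\<psi> (x \<star> y) = \<psi> x \<star>' \<psi> y" if "x \<in> carrier AV" "y \<in> carrier AV" for x y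
    using that \<psi>\<phi>[of "\<psi> x \<star>' \<psi> y"] by (simp add: \<phi>_mult \<phi>\<psi> closed)
  have \<psi>_unit: "\<psi> (a \<bullet> unitV) = a \<bullet> unitV" if "a \<in> carrier A" for a
    using \<psi>\<phi>[of "a \<bullet> unitV"] that by (simp add: \<phi>_unit closed)
  have \<phi>_act: "\<phi> (a \<rhd> x) = a \<rhd> \<phi> x" if "a \<in> carrier A" "x \<in> carrier AV" for a x
    using that \<phi>_mult[of "a \<bullet> unitV" x] by (simp add: \<phi>_unit unitV_cmult D.unitV_cmult closed)
  have \<psi>_act: "\<psi> (a \<rhd> x) = a \<rhd> \<psi> x" if "a \<in> carrier A" "x \<in> carrier AV" for a x
    using that \<psi>_mult[of "a \<bullet> unitV" x] by (simp add: \<psi>_unit unitV_cmult D.unitV_cmult closed)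
  define \<theta> where "\<theta> v = \<phi> (\<one>\<^bsub>A\<^esub> \<bullet> v)" for v
  define \<gamma> where "\<gamma> v = \<psi> (\<one>\<^bsub>A\<^esub> \<bullet> v)" for v
  have \<theta>: "\<theta> \<in> linear_maps K V AV"
    unfolding \<theta>_def[abs_def] by (intro linear_maps_comp[OF pure_tensor_linear_right \<phi>_lin] modules A.one_closed)
  have \<gamma>: "\<gamma> \<in> linear_maps K V AV"
    unfolding \<gamma>_def[abs_def] by (intro linear_maps_comp[OF pure_tensor_linear_right \<psi>_lin] modules A.one_closed)
  have lext_\<theta>: "lext \<theta> x = \<phi> x" and lext_\<gamma>: "lext \<gamma> x = \<psi> x" if "x \<in> carrier AV" for x
    unfolding \<theta>_def[abs_def] \<gamma>_def[abs_def]
    using left_linear_eq_lext[OF \<phi>_lin \<phi>_act that] left_linear_eq_lext[OF \<psi>_lin \<psi>_act that] by simp_all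
  note \<theta>\<gamma>_closed = linear_maps_closed[OF \<theta>] linear_maps_closed[OF \<gamma>]
  have \<gamma>R: "lext \<gamma> (R (pure_tensor K V A v a)) = \<gamma> v \<star>' (a \<bullet> unitV)"
    if "v \<in> carrier V" "a \<in> carrier A" for v a
    using that by (simp add: R_eq_cmult lext_\<gamma> closed \<psi>_mult \<psi>_unit \<gamma>_def)
  have "equivalence_maps \<theta> \<gamma>"
    unfolding equivalence_maps_def
  proof (intro conjI ballI)
    show "R' (pure_tensor K V A v a) = lext \<gamma> (\<theta> v \<star> (a \<bullet> unitV))" if "v \<in> carrier V" "a \<in> carrier A" for v a
      using that by (simp add: D.R_eq_cmult lext_\<gamma> closed \<theta>\<gamma>_closed \<psi>_mult \<psi>_unit) (simp add: \<theta>_def \<psi>\<phi> closed)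
    show "\<sigma>' (pure_tensor K V V v w) = lext \<gamma> (\<theta> v \<star> \<theta> w)" if "v \<in> carrier V" "w \<in> carrier V" for v w
      using that by (simp add: D.\<sigma>_eq_cmult lext_\<gamma> closed \<theta>\<gamma>_closed \<psi>_mult) (simp add: \<theta>_def \<psi>\<phi> closed)
    show "mixed_product \<gamma> (pure_tensor K V V v w) = lext \<gamma> (\<sigma> (pure_tensor K V V v w))"
      if "v \<in> carrier V" "w \<in> carrier V" for v w
      using that mixed_product_pure[OF \<gamma> that \<gamma>R] by (simp add: \<sigma>_eq_cmult lext_\<gamma> closed \<psi>_mult \<gamma>_def)
    show "\<theta> unitV = \<one>\<^bsub>A\<^esub> \<bullet> unitV" "\<gamma> unitV = \<one>\<^bsub>A\<^esub> \<bullet> unitV"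
      by (simp_all add: \<theta>_def \<gamma>_def \<phi>_unit \<psi>_unit)
    show "lext \<gamma> (\<theta> v) = \<one>\<^bsub>A\<^esub> \<bullet> v" "lext \<theta> (\<gamma> v) = \<one>\<^bsub>A\<^esub> \<bullet> v" if "v \<in> carrier V" for v
      using that by (simp_all add: lext_\<theta> lext_\<gamma> \<theta>\<gamma>_closed) (simp_all add: \<theta>_def \<gamma>_def \<psi>\<phi> \<phi>\<psi> closed)
  qed
  with \<theta> \<gamma> show ?thesis by blast
qed

end


theorem theorem2p3:
  fixes K :: "'k ring" and A :: "('k, 'a) module" and V :: "('k, 'v) module" and unitV :: 'v
    and R R' :: "('v \<times> 'a \<Rightarrow> 'k) set \<Rightarrow> ('a \<times> 'v \<Rightarrow> 'k) set"
    and \<sigma> \<sigma>' :: "('v \<times> 'v \<Rightarrow> 'k) set \<Rightarrow> ('a \<times> 'v \<Rightarrow> 'k) set"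
  assumes "crossed_product_data K A V unitV R \<sigma>"
    and "crossed_product_data K A V unitV R' \<sigma>'"
  shows "equivalent_crossed_products K A V unitV R \<sigma> R' \<sigma>' \<longleftrightarrow>
    (\<exists>\<theta> \<in> linear_maps K V (A \<boxtimes>\<^bsub>K\<^esub> V). \<exists>\<gamma> \<in> linear_maps K V (A \<boxtimes>\<^bsub>K\<^esub> V).
      (\<forall>t \<in> carrier (V \<boxtimes>\<^bsub>K\<^esub> A).
        R' t =
        (mult2_first K A V \<circ>
         tensor_map K A (A \<boxtimes>\<^bsub>K\<^esub> (A \<boxtimes>\<^bsub>K\<^esub> V)) id (tensor_map K A (A \<boxtimes>\<^bsub>K\<^esub> V) id \<gamma>) \<circ>
         tensor_map K A (A \<boxtimes>\<^bsub>K\<^esub> V) id R \<circ>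
         (tensor_assoc K A V A \<circ> tensor_map K (A \<boxtimes>\<^bsub>K\<^esub> V) A \<theta> id)) t) \<and>
      (\<forall>t \<in> carrier (V \<boxtimes>\<^bsub>K\<^esub> V).
        \<sigma>' t =
        (mult_first K A V \<circ>
         tensor_map K A (A \<boxtimes>\<^bsub>K\<^esub> V) id \<gamma> \<circ>
         mult2_first K A V \<circ>
         tensor_map K A (A \<boxtimes>\<^bsub>K\<^esub> (A \<boxtimes>\<^bsub>K\<^esub> V)) id (tensor_map K A (A \<boxtimes>\<^bsub>K\<^esub> V) id \<sigma>) \<circ>
         tensor_map K A (A \<boxtimes>\<^bsub>K\<^esub> (V \<boxtimes>\<^bsub>K\<^esub> V)) id (tensor_first K V A A V V R) \<circ>
         (tensor_assoc K A V (A \<boxtimes>\<^bsub>K\<^esub> V) \<circ>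
          tensor_map K (A \<boxtimes>\<^bsub>K\<^esub> V) (A \<boxtimes>\<^bsub>K\<^esub> V) \<theta> \<theta>)) t) \<and>
      \<theta> unitV = pure_tensor K A V \<one>\<^bsub>A\<^esub> unitV \<and>
      \<gamma> unitV = pure_tensor K A V \<one>\<^bsub>A\<^esub> unitV \<and>
      (\<forall>v \<in> carrier V.
        (mult_first K A V \<circ> tensor_map K A (A \<boxtimes>\<^bsub>K\<^esub> V) id \<gamma> \<circ> \<theta>) v =
        pure_tensor K A V \<one>\<^bsub>A\<^esub> v) \<and>
      (\<forall>v \<in> carrier V.
        (mult_first K A V \<circ> tensor_map K A (A \<boxtimes>\<^bsub>K\<^esub> V) id \<theta> \<circ> \<gamma>) v =
        pure_tensor K A V \<one>\<^bsub>A\<^esub> v) \<and>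
      (\<forall>t \<in> carrier (V \<boxtimes>\<^bsub>K\<^esub> V).
        (mult_first K A V \<circ>
         (tensor_map K A (A \<boxtimes>\<^bsub>K\<^esub> V) (mult_map K A) \<sigma>' \<circ> tensor_unassoc K A A (V \<boxtimes>\<^bsub>K\<^esub> V)) \<circ>
         tensor_map K A (A \<boxtimes>\<^bsub>K\<^esub> (V \<boxtimes>\<^bsub>K\<^esub> V)) id
           (tensor_assoc K A V V \<circ> tensor_map K (A \<boxtimes>\<^bsub>K\<^esub> V) V \<gamma> id) \<circ>
         tensor_first K V A A V V R \<circ>
         tensor_map K V (A \<boxtimes>\<^bsub>K\<^esub> V) id \<gamma>) t =
        (mult_first K A V \<circ> tensor_map K A (A \<boxtimes>\<^bsub>K\<^esub> V) id \<gamma> \<circ> \<sigma>) t))"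
proof -
  interpret crossed_product_pair K A V unitV R \<sigma> R' \<sigma>'
    using assms by (rule crossed_product_pair.intro)
  have "equivalent_crossed_products K A V unitV R \<sigma> R' \<sigma>' \<longleftrightarrow>
      (\<exists>\<theta> \<in> linear_maps K V AV. \<exists>\<gamma> \<in> linear_maps K V AV. equivalence_maps \<theta> \<gamma>)"
    using maps_of_isomorphism isomorphism_of_maps by blast
  \<comment> \<open>the remaining difference to the claim is the passage between tensors and pure tensors, for each
    condition separately\<close>
  then show ?thesis
    unfolding equivalence_maps_def
    apply (rule trans)
    apply (intro bex_cong refl conj_cong)
    subgoal by (rule twisting_condition_iff[symmetric])
    subgoal using cocycle_condition_iff by (simp only: crossed_mult_def left_extension_def comp_apply)
    subgoal by (simp only: left_extension_def comp_apply)
    subgoal by (simp only: left_extension_def comp_apply)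
    subgoal using mixed_condition_iff by (simp only: mixed_product_def left_extension_def comp_apply)
    done
qed

end
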